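(* Let $\mathcal{C}$ be a triangulated category with suspension functor $\Sigma$, and let $\mathcal{T}$ be a contravariantly finite, rigid subcategory of $\mathcal{C}$ (strictly full and stable under taking direct summands). Let $\mathcal{W}$ be the class of morphisms $f:X\to Y$ such that, for any (equivalently, some) triangle $Z\xrightarrow{u}X\xrightarrow{f}Y\xrightarrow{v}\Sigma Z$, the morphisms $u$ and $v$ are in $(\mathcal{T}^\perp)$. Then the inclusion of $\mathcal{T}\ast\Sigma\mathcal{T}$ into $\mathcal{C}$ induces an equivalence of categories $$\mathcal{T}\ast\Sigma\mathcal{T}/(\Sigma\mathcal{T})\simeq\mathcal{C}[\mathcal{W}^{-1}].$$
   Context: Strictly full means full and closed under isomorphism. For a full subcategory $\mathcal{D}$ of $\mathcal{C}$: $\mathcal{D}^\perp$ is the full subcategory of objects $X$ with $\mathcal{C}(D,X)=0$ for all $D\in\mathcal{D}$; $(\mathcal{D})$ is the ideal of morphisms factoring through some object of $\mathcal{D}$; $\mathcal{D}$ is rigid if $\Sigma\mathcal{D}\subseteq\mathcal{D}^\perp$; $\mathcal{D}$ is contravariantly finite if every $X\in\mathcal{C}$ has a right $\mathcal{D}$-approximation, i.e. a morphism $D\to X$ with $D\in\mathcal{D}$ through which every morphism $D'\to X$ with $D'\in\mathcal{D}$ factors. $\mathcal{T}\ast\Sigma\mathcal{T}$ is the full subcategory of objects $Y$ for which there is a triangle $T_1\to T_0\to Y\to\Sigma T_1$ with $T_0,T_1\in\mathcal{T}$; $\mathcal{T}\ast\Sigma\mathcal{T}/(\Sigma\mathcal{T})$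 is its quotient by the ideal of morphisms factoring through $\Sigma\mathcal{T}$. The localisation of $\mathcal{C}$ at $\mathcal{W}$ is a functor $L:\mathcal{C}\to\mathcal{C}[\mathcal{W}^{-1}]$ that sends morphisms in $\mathcal{W}$ to isomorphisms and has the property that any functor $F:\mathcal{C}\to\mathcal{D}$ sending morphisms in $\mathcal{W}$ to isomorphisms factors as $F=GL$ (strict equality) for a unique functor $G$. The functor "induced by the inclusion" is the one obtained from $\mathcal{T}\ast\Sigma\mathcal{T}\hookrightarrow\mathcal{C}\xrightarrow{L}\mathcal{C}[\mathcal{W}^{-1}]$ by passing to the quotient. *)

theory Defs
  imports "HOL-Algebra.Group"
begin

section \<open>Categories and functors\<close>

text \<open>Every arrow determines its domain and codomain; the values of the operations outside the
  carriers \<open>Obj\<close> and \<open>Arr\<close> are irrelevant.\<close>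

record ('o, 'a) cat =
  Obj :: "'o set"
  Arr :: "'a set"
  Dom :: "'a \<Rightarrow> 'o"
  Cod :: "'a \<Rightarrow> 'o"
  Ident :: "'o \<Rightarrow> 'a"
  Comp :: "'a \<Rightarrow> 'a \<Rightarrow> 'a"  (infixl "\<cdot>\<index>" 70)

definition Hom :: "('o, 'a, 'z) cat_scheme \<Rightarrow> 'o \<Rightarrow> 'o \<Rightarrow> 'a set" where
  "Hom C X Y = {f \<in> Arr C. Dom C f = X \<and> Cod C f = Y}"

locale category =
  fixes C :: "('o, 'a, 'z) cat_scheme" (structure)
  assumes Dom_in_Obj: "f \<in> Arr C \<Longrightarrow> Dom C f \<in> Obj C"
    and Cod_in_Obj: "f \<in> Arr C \<Longrightarrow> Cod C f \<in> Obj C"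
    and Ident_in_Hom: "X \<in> Obj C \<Longrightarrow> Ident C X \<in> Hom C X X"
    and Comp_in_Hom: "\<lbrakk>f \<in> Hom C X Y; g \<in> Hom C Y Z\<rbrakk> \<Longrightarrow> g \<cdot> f \<in> Hom C X Z"
    and Comp_Ident: "f \<in> Hom C X Y \<Longrightarrow> f \<cdot> Ident C X = f"
    and Ident_Comp: "f \<in> Hom C X Y \<Longrightarrow> Ident C Y \<cdot> f = f"
    and Comp_assoc: "\<lbrakk>f \<in> Hom C W X; g \<in> Hom C X Y; h \<in> Hom C Y Z\<rbrakk>
      \<Longrightarrow> (h \<cdot> g) \<cdot> f = h \<cdot> (g \<cdot> f)"

definition is_iso :: "('o, 'a, 'z) cat_scheme \<Rightarrow> 'a \<Rightarrow> bool" where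
  "is_iso C f \<longleftrightarrow> f \<in> Arr C \<and> (\<exists>g \<in> Hom C (Cod C f) (Dom C f).
     g \<cdot>\<^bsub>C\<^esub> f = Ident C (Dom C f) \<and> f \<cdot>\<^bsub>C\<^esub> g = Ident C (Cod C f))"

definition isomorphic_objs :: "('o, 'a, 'z) cat_scheme \<Rightarrow> 'o \<Rightarrow> 'o \<Rightarrow> bool" where
  "isomorphic_objs C X Y \<longleftrightarrow> (\<exists>f \<in> Hom C X Y. is_iso C f)"

record ('o, 'a, 'p, 'b) funct =
  omap :: "'o \<Rightarrow> 'p"
  amap :: "'a \<Rightarrow> 'b"

locale cat_functor = dom: category C + cod: category D
  for C :: "('o, 'a, 'z) cat_scheme" and D :: "('p, 'b, 'y) cat_scheme"
    and F :: "('o, 'a, 'p, 'b) funct" +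
  assumes omap_in_Obj: "X \<in> Obj C \<Longrightarrow> omap F X \<in> Obj D"
    and amap_in_Hom: "f \<in> Hom C X Y \<Longrightarrow> amap F f \<in> Hom D (omap F X) (omap F Y)"
    and amap_Ident: "X \<in> Obj C \<Longrightarrow> amap F (Ident C X) = Ident D (omap F X)"
    and amap_Comp: "\<lbrakk>f \<in> Hom C X Y; g \<in> Hom C Y Z\<rbrakk>
      \<Longrightarrow> amap F (g \<cdot>\<^bsub>C\<^esub> f) = amap F g \<cdot>\<^bsub>D\<^esub> amap F f"

text \<open>Strict equality of functors defined on \<open>C\<close>; functor data may differ off the carriers.\<close>

definition functor_eq ::
  "('o, 'a, 'z) cat_scheme \<Rightarrow> ('o, 'a, 'p, 'b) funct \<Rightarrow> ('o, 'a, 'p, 'b) funct \<Rightarrow> bool" where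
  "functor_eq C F G \<longleftrightarrow>
     (\<forall>X \<in> Obj C. omap F X = omap G X) \<and> (\<forall>f \<in> Arr C. amap F f = amap G f)"

definition id_functor :: "('o, 'a, 'o, 'a) funct" where
  "id_functor = \<lparr>omap = \<lambda>X. X, amap = \<lambda>f. f\<rparr>"

definition comp_functor ::
  "('p, 'b, 'q, 'c) funct \<Rightarrow> ('o, 'a, 'p, 'b) funct \<Rightarrow> ('o, 'a, 'q, 'c) funct"
  (infixl "\<circ>\<^sub>F" 55) where
  "G \<circ>\<^sub>F F = \<lparr>omap = omap G \<circ> omap F, amap = amap G \<circ> amap F\<rparr>"

definition naturally_isomorphic ::
  "('o, 'a, 'z) cat_scheme \<Rightarrow> ('p, 'b, 'y) cat_scheme
   \<Rightarrow> ('o, 'a, 'p, 'b) funct \<Rightarrow> ('o, 'a, 'p, 'b) funct \<Rightarrow> bool" where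
  "naturally_isomorphic C D F G \<longleftrightarrow>
     cat_functor C D F \<and> cat_functor C D G \<and>
     (\<exists>\<eta>. (\<forall>X \<in> Obj C. \<eta> X \<in> Hom D (omap F X) (omap G X) \<and> is_iso D (\<eta> X)) \<and>
          (\<forall>f \<in> Arr C. \<eta> (Cod C f) \<cdot>\<^bsub>D\<^esub> amap F f = amap G f \<cdot>\<^bsub>D\<^esub> \<eta> (Dom C f)))"

definition equivalence_functor ::
  "('o, 'a, 'z) cat_scheme \<Rightarrow> ('p, 'b, 'y) cat_scheme \<Rightarrow> ('o, 'a, 'p, 'b) funct \<Rightarrow> bool" where
  "equivalence_functor C D F \<longleftrightarrow>
     cat_functor C D F \<and>
     (\<exists>G. cat_functor D C G \<and>
          naturally_isomorphic C C id_functor (G \<circ>\<^sub>F F) \<and>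
          naturally_isomorphic D D id_functor (F \<circ>\<^sub>F G))"

definition full_subcat :: "('o, 'a, 'z) cat_scheme \<Rightarrow> 'o set \<Rightarrow> ('o, 'a, 'z) cat_scheme" where
  "full_subcat C S = C\<lparr>Obj := S, Arr := {f \<in> Arr C. Dom C f \<in> S \<and> Cod C f \<in> S}\<rparr>"


section \<open>Localisation\<close>

definition inverts ::
  "'a set \<Rightarrow> ('p, 'b, 'y) cat_scheme \<Rightarrow> ('o, 'a, 'p, 'b) funct \<Rightarrow> bool" where
  "inverts W D F \<longleftrightarrow> (\<forall>f \<in> W. is_iso D (amap F f))"

definition universal_for ::
  "('o, 'a, 'z) cat_scheme \<Rightarrow> 'a set \<Rightarrow> ('p, 'b, 'y) cat_scheme \<Rightarrow> ('o, 'a, 'p, 'b) funct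
   \<Rightarrow> ('d, 'e) cat \<Rightarrow> bool" where
  "universal_for C W Loc L D \<longleftrightarrow>
     (\<forall>F. cat_functor C D F \<and> inverts W D F \<longrightarrow>
        (\<exists>G. cat_functor Loc D G \<and> functor_eq C F (G \<circ>\<^sub>F L) \<and>
             (\<forall>G'. cat_functor Loc D G' \<and> functor_eq C F (G' \<circ>\<^sub>F L) \<longrightarrow> functor_eq Loc G' G)))"

text \<open>The universal property of a localisation ranges over all categories \<open>D\<close>. Types cannot be
  quantified inside a formula, so \<open>is_localisation\<close> asks for it only for those \<open>D\<close> whose objects
  and arrows live in the types of \<open>C\<close> or in the types of \<open>Loc\<close>. The unrestricted universal property
  implies this one, so a theorem that assumes \<open>is_localisation\<close> applies to every localisation.\<close>

definition is_localisation ::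
  "('o, 'a, 'z) cat_scheme \<Rightarrow> 'a set \<Rightarrow> ('p, 'b) cat \<Rightarrow> ('o, 'a, 'p, 'b) funct \<Rightarrow> bool" where
  "is_localisation C W Loc L \<longleftrightarrow>
     cat_functor C Loc L \<and> inverts W Loc L \<and>
     (\<forall>D :: ('o, 'a) cat. universal_for C W Loc L D) \<and>
     (\<forall>D :: ('p, 'b) cat. universal_for C W Loc L D)"


section \<open>Additive categories\<close>

record ('o, 'a) addcat = "('o, 'a) cat" +
  Add :: "'a \<Rightarrow> 'a \<Rightarrow> 'a"  (infixl "\<boxplus>\<index>" 65)
  Zero :: "'o \<Rightarrow> 'o \<Rightarrow> 'a"

definition hom_group :: "('o, 'a, 'z) addcat_scheme \<Rightarrow> 'o \<Rightarrow> 'o \<Rightarrow> 'a monoid" where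
  "hom_group C X Y = \<lparr>carrier = Hom C X Y, mult = Add C, one = Zero C X Y\<rparr>"

definition Neg :: "('o, 'a, 'z) addcat_scheme \<Rightarrow> 'a \<Rightarrow> 'a" where
  "Neg C f = inv\<^bsub>hom_group C (Dom C f) (Cod C f)\<^esub> f"

locale preadditive_category = category C
  for C :: "('o, 'a, 'z) addcat_scheme" (structure) +
  assumes hom_comm_group: "\<lbrakk>X \<in> Obj C; Y \<in> Obj C\<rbrakk> \<Longrightarrow> comm_group (hom_group C X Y)"
    and Comp_Add: "\<lbrakk>f \<in> Hom C X Y; f' \<in> Hom C X Y; g \<in> Hom C Y Z\<rbrakk>
      \<Longrightarrow> g \<cdot> (f \<boxplus> f') = (g \<cdot> f) \<boxplus> (g \<cdot> f')"
    and Add_Comp: "\<lbrakk>f \<in> Hom C X Y; g \<in> Hom C Y Z; g' \<in> Hom C Y Z\<rbrakk>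
      \<Longrightarrow> (g \<boxplus> g') \<cdot> f = (g \<cdot> f) \<boxplus> (g' \<cdot> f)"

definition zero_object :: "('o, 'a, 'z) cat_scheme \<Rightarrow> 'o \<Rightarrow> bool" where
  "zero_object C O' \<longleftrightarrow> O' \<in> Obj C \<and>
     (\<forall>X \<in> Obj C. (\<exists>!f. f \<in> Hom C X O') \<and> (\<exists>!f. f \<in> Hom C O' X))"

definition biproduct ::
  "('o, 'a, 'z) addcat_scheme \<Rightarrow> 'o \<Rightarrow> 'o \<Rightarrow> 'o \<Rightarrow> 'a \<Rightarrow> 'a \<Rightarrow> 'a \<Rightarrow> 'a \<Rightarrow> bool" where
  "biproduct C X Y S i\<^sub>1 i\<^sub>2 p\<^sub>1 p\<^sub>2 \<longleftrightarrow>
     S \<in> Obj C \<and> i\<^sub>1 \<in> Hom C X S \<and> i\<^sub>2 \<in> Hom C Y S \<and> p\<^sub>1 \<in> Hom C S X \<and> p\<^sub>2 \<in> Hom C S Y \<and>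
     p\<^sub>1 \<cdot>\<^bsub>C\<^esub> i\<^sub>1 = Ident C X \<and> p\<^sub>2 \<cdot>\<^bsub>C\<^esub> i\<^sub>2 = Ident C Y \<and>
     p\<^sub>2 \<cdot>\<^bsub>C\<^esub> i\<^sub>1 = Zero C X Y \<and> p\<^sub>1 \<cdot>\<^bsub>C\<^esub> i\<^sub>2 = Zero C Y X \<and>
     (i\<^sub>1 \<cdot>\<^bsub>C\<^esub> p\<^sub>1) \<boxplus>\<^bsub>C\<^esub> (i\<^sub>2 \<cdot>\<^bsub>C\<^esub> p\<^sub>2) = Ident C S"

locale additive_category = preadditive_category +
  assumes ex_zero_object: "\<exists>O'. zero_object C O'"
    and ex_biproduct: "\<lbrakk>X \<in> Obj C; Y \<in> Obj C\<rbrakk>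
      \<Longrightarrow> \<exists>S i\<^sub>1 i\<^sub>2 p\<^sub>1 p\<^sub>2. biproduct C X Y S i\<^sub>1 i\<^sub>2 p\<^sub>1 p\<^sub>2"


section \<open>Quotients by ideals\<close>

definition factor_ideal :: "('o, 'a, 'z) cat_scheme \<Rightarrow> 'o set \<Rightarrow> 'a set" where
  "factor_ideal C S = {f \<in> Arr C.
     \<exists>D \<in> S. \<exists>g \<in> Hom C (Dom C f) D. \<exists>h \<in> Hom C D (Cod C f). f = h \<cdot>\<^bsub>C\<^esub> g}"

definition ideal_class :: "('o, 'a, 'z) addcat_scheme \<Rightarrow> 'a set \<Rightarrow> 'a \<Rightarrow> 'a set" where
  "ideal_class C I f = {g \<in> Hom C (Dom C f) (Cod C f). g \<boxplus>\<^bsub>C\<^esub> Neg C f \<in> I}"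

text \<open>Arrows of the quotient are congruence classes of arrows; domain, codomain and composition
  are computed on arbitrary representatives.\<close>

definition quotient_cat :: "('o, 'a, 'z) addcat_scheme \<Rightarrow> 'a set \<Rightarrow> ('o, 'a set) cat" where
  "quotient_cat C I =
     \<lparr>Obj = Obj C,
      Arr = ideal_class C I ` Arr C,
      Dom = \<lambda>\<phi>. Dom C (SOME f. f \<in> \<phi>),
      Cod = \<lambda>\<phi>. Cod C (SOME f. f \<in> \<phi>),
      Ident = \<lambda>X. ideal_class C I (Ident C X),
      Comp = \<lambda>\<psi> \<phi>. ideal_class C I ((SOME g. g \<in> \<psi>) \<cdot>\<^bsub>C\<^esub> (SOME f. f \<in> \<phi>))\<rparr>"

definition quotient_functor ::
  "('o, 'a, 'z) addcat_scheme \<Rightarrow> 'a set \<Rightarrow> ('o, 'a, 'o, 'a set) funct" where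
  "quotient_functor C I = \<lparr>omap = \<lambda>X. X, amap = ideal_class C I\<rparr>"


section \<open>Triangulated categories\<close>

text \<open>A triangle \<open>X \<rightarrow> Y \<rightarrow> Z \<rightarrow> \<Sigma>X\<close> is recorded by its three arrows.\<close>

record ('o, 'a) tricat = "('o, 'a) addcat" +
  Susp :: "('o, 'a, 'o, 'a) funct"
  Triangles :: "('a \<times> 'a \<times> 'a) set"

definition candidate_triangle ::
  "('o, 'a, 'z) tricat_scheme \<Rightarrow> 'a \<Rightarrow> 'a \<Rightarrow> 'a \<Rightarrow> bool" where
  "candidate_triangle C u v w \<longleftrightarrow>
     u \<in> Arr C \<and> v \<in> Arr C \<and> w \<in> Arr C \<and>
     Dom C v = Cod C u \<and> Dom C w = Cod C v \<and> Cod C w = omap (Susp C) (Dom C u)"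

text \<open>The suspension is only required to be an additive autoequivalence, not an automorphism.\<close>

locale triangulated_category = additive_category C
  for C :: "('o, 'a, 'z) tricat_scheme" (structure) +
  assumes Susp_equivalence: "equivalence_functor C C (Susp C)"
    and Susp_Add: "\<lbrakk>f \<in> Hom C X Y; g \<in> Hom C X Y\<rbrakk>
      \<Longrightarrow> amap (Susp C) (f \<boxplus> g) = amap (Susp C) f \<boxplus> amap (Susp C) g"
    and Triangles_candidate: "(u, v, w) \<in> Triangles C \<Longrightarrow> candidate_triangle C u v w"
    and TR1_iso: "\<lbrakk>(u, v, w) \<in> Triangles C; candidate_triangle C u' v' w';
        a \<in> Hom C (Dom C u) (Dom C u'); b \<in> Hom C (Dom C v) (Dom C v');
        c \<in> Hom C (Dom C w) (Dom C w'); is_iso C a; is_iso C b; is_iso C c;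
        b \<cdot> u = u' \<cdot> a; c \<cdot> v = v' \<cdot> b; amap (Susp C) a \<cdot> w = w' \<cdot> c\<rbrakk>
      \<Longrightarrow> (u', v', w') \<in> Triangles C"
    and TR1_Ident: "\<lbrakk>X \<in> Obj C; zero_object C O'\<rbrakk>
      \<Longrightarrow> (Ident C X, Zero C X O', Zero C O' (omap (Susp C) X)) \<in> Triangles C"
    and TR1_complete: "u \<in> Arr C \<Longrightarrow> \<exists>v w. (u, v, w) \<in> Triangles C"
    and TR2: "candidate_triangle C u v w
      \<Longrightarrow> (u, v, w) \<in> Triangles C \<longleftrightarrow> (v, w, Neg C (amap (Susp C) u)) \<in> Triangles C"
    and TR3: "\<lbrakk>(u, v, w) \<in> Triangles C; (u', v', w') \<in> Triangles C;
        a \<in> Hom C (Dom C u) (Dom C u'); b \<in> Hom C (Dom C v) (Dom C v'); b \<cdot> u = u' \<cdot> a\<rbrakk>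
      \<Longrightarrow> \<exists>c \<in> Hom C (Dom C w) (Dom C w').
            c \<cdot> v = v' \<cdot> b \<and> amap (Susp C) a \<cdot> w = w' \<cdot> c"
    and TR4: "\<lbrakk>f \<in> Hom C X Y; g \<in> Hom C Y Z;
        (f, f', f'') \<in> Triangles C; (g, g', g'') \<in> Triangles C;
        (g \<cdot> f, h', h'') \<in> Triangles C\<rbrakk>
      \<Longrightarrow> \<exists>a \<in> Hom C (Cod C f') (Cod C h'). \<exists>b \<in> Hom C (Cod C h') (Cod C g').
            (a, b, amap (Susp C) f' \<cdot> g'') \<in> Triangles C \<and>
            a \<cdot> f' = h' \<cdot> g \<and> h'' \<cdot> a = f'' \<and>
            b \<cdot> h' = g' \<and> g'' \<cdot> b = amap (Susp C) f \<cdot> h''"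


section \<open>Contravariantly finite rigid subcategories\<close>

text \<open>Full subcategories of \<open>C\<close> are represented by their sets of objects.\<close>

definition strictly_full :: "('o, 'a, 'z) cat_scheme \<Rightarrow> 'o set \<Rightarrow> bool" where
  "strictly_full C T \<longleftrightarrow> T \<subseteq> Obj C \<and>
     (\<forall>X \<in> T. \<forall>Y \<in> Obj C. isomorphic_objs C X Y \<longrightarrow> Y \<in> T)"

definition closed_under_summands :: "('o, 'a, 'z) addcat_scheme \<Rightarrow> 'o set \<Rightarrow> bool" where
  "closed_under_summands C T \<longleftrightarrow>
     (\<forall>S \<in> T. \<forall>X \<in> Obj C. \<forall>Y \<in> Obj C.
        (\<exists>i\<^sub>1 i\<^sub>2 p\<^sub>1 p\<^sub>2. biproduct C X Y S i\<^sub>1 i\<^sub>2 p\<^sub>1 p\<^sub>2) \<longrightarrow> X \<in> T)"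

definition right_approximation :: "('o, 'a, 'z) cat_scheme \<Rightarrow> 'o set \<Rightarrow> 'o \<Rightarrow> 'a \<Rightarrow> bool" where
  "right_approximation C T X p \<longleftrightarrow>
     (\<exists>D \<in> T. p \<in> Hom C D X \<and> (\<forall>D' \<in> T. \<forall>g \<in> Hom C D' X. \<exists>h \<in> Hom C D' D. g = p \<cdot>\<^bsub>C\<^esub> h))"

definition contravariantly_finite :: "('o, 'a, 'z) cat_scheme \<Rightarrow> 'o set \<Rightarrow> bool" where
  "contravariantly_finite C T \<longleftrightarrow> (\<forall>X \<in> Obj C. \<exists>p. right_approximation C T X p)"

definition right_perp :: "('o, 'a, 'z) addcat_scheme \<Rightarrow> 'o set \<Rightarrow> 'o set" where
  "right_perp C T = {X \<in> Obj C. \<forall>D \<in> T. Hom C D X = {Zero C D X}}"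

definition suspension :: "('o, 'a, 'z) tricat_scheme \<Rightarrow> 'o set \<Rightarrow> 'o set" where
  "suspension C T = omap (Susp C) ` T"

definition rigid :: "('o, 'a, 'z) tricat_scheme \<Rightarrow> 'o set \<Rightarrow> bool" where
  "rigid C T \<longleftrightarrow> suspension C T \<subseteq> right_perp C T"

text \<open>The objects of \<open>T * \<Sigma>T\<close>, i.e. the cones of morphisms in \<open>T\<close>.\<close>

definition T_star_Susp_T :: "('o, 'a, 'z) tricat_scheme \<Rightarrow> 'o set \<Rightarrow> 'o set" where
  "T_star_Susp_T C T = {Y \<in> Obj C. \<exists>T\<^sub>1 \<in> T. \<exists>T\<^sub>0 \<in> T. \<exists>f g h.
     f \<in> Hom C T\<^sub>1 T\<^sub>0 \<and> g \<in> Hom C T\<^sub>0 Y \<and> h \<in> Hom C Y (omap (Susp C) T\<^sub>1) \<and>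
     (f, g, h) \<in> Triangles C}"

definition W_class :: "('o, 'a, 'z) tricat_scheme \<Rightarrow> 'o set \<Rightarrow> 'a set" where
  "W_class C T = {f \<in> Arr C. \<forall>u v. (u, f, v) \<in> Triangles C \<longrightarrow>
     u \<in> factor_ideal C (right_perp C T) \<and> v \<in> factor_ideal C (right_perp C T)}"

definition star_subcat :: "('o, 'a, 'z) tricat_scheme \<Rightarrow> 'o set \<Rightarrow> ('o, 'a, 'z) tricat_scheme" where
  "star_subcat C T = full_subcat C (T_star_Susp_T C T)"

text \<open>\<open>(\<Sigma>T)\<close> as an ideal of the category \<open>T * \<Sigma>T\<close>.\<close>

definition Susp_ideal :: "('o, 'a, 'z) tricat_scheme \<Rightarrow> 'o set \<Rightarrow> 'a set" where
  "Susp_ideal C T = factor_ideal (star_subcat C T) (suspension C T)"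

definition star_quotient :: "('o, 'a, 'z) tricat_scheme \<Rightarrow> 'o set \<Rightarrow> ('o, 'a set) cat" where
  "star_quotient C T = quotient_cat (star_subcat C T) (Susp_ideal C T)"

text \<open>\<open>J : T * \<Sigma>T / (\<Sigma>T) \<rightarrow> Loc\<close> is obtained from the composite of the inclusion
  \<open>T * \<Sigma>T \<rightarrow> C\<close> (whose object and arrow maps are identities) with \<open>L : C \<rightarrow> Loc\<close> by passing to the
  quotient.\<close>

definition induced_by_inclusion ::
  "('o, 'a, 'z) tricat_scheme \<Rightarrow> 'o set \<Rightarrow> ('p, 'b) cat \<Rightarrow> ('o, 'a, 'p, 'b) funct
   \<Rightarrow> ('o, 'a set, 'p, 'b) funct \<Rightarrow> bool" where
  "induced_by_inclusion C T Loc L J \<longleftrightarrow>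
     cat_functor (star_quotient C T) Loc J \<and>
     functor_eq (star_subcat C T)
       (J \<circ>\<^sub>F quotient_functor (star_subcat C T) (Susp_ideal C T))
       (L \<circ>\<^sub>F id_functor)"

end

theory Submission
  imports Defs
begin

text \<open>
  Everything is controlled by the functors \<open>C(D, -)\<close> with \<open>D\<close> in \<open>T\<close>. The cone of a right
  \<open>T\<close>-approximation lies in \<open>T\<^sup>\<bottom>\<close>, so a morphism belongs to the ideal \<open>(T\<^sup>\<bottom>)\<close> exactly when all
  \<open>C(D, -)\<close> send it to zero (\<open>factor_perp_iff\<close>); by exactness, \<open>\<W>\<close> is then the class of
  morphisms that all \<open>C(D, -)\<close> send to bijections (\<open>W_iff_T_bijective\<close>). Write \<open>f \<approx> g\<close> when
  \<open>C(D, f) = C(D, g)\<close> for all \<open>D\<close>.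

  Three facts make \<open>T * \<Sigma>T\<close> behave like a subcategory of cofibrant objects. Every object \<open>X\<close> receives
  a morphism \<open>q : QX \<rightarrow> X\<close> in \<open>\<W>\<close> from an object of \<open>T * \<Sigma>T\<close>, built from two successive
  approximations (\<open>resolution\<close>). Morphisms out of an object of \<open>T * \<Sigma>T\<close> lift along morphisms in \<open>\<W>\<close>,
  uniquely up to \<open>\<approx>\<close> (\<open>lift_along_W\<close>, \<open>W_left_cancel\<close>). On \<open>T * \<Sigma>T\<close> the relation \<open>\<approx>\<close> is congruence
  modulo \<open>(\<Sigma>T)\<close> (\<open>Susp_ideal_iff\<close>). Hence \<open>X \<mapsto> QX\<close> is a functor from \<open>C\<close> to the quotient which inverts
  \<open>\<W>\<close> (\<open>resolution_functor\<close>), and it induces a functor \<open>G\<close> on the localisation.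

  In the other direction, every functor that inverts \<open>\<W>\<close> identifies \<open>\<approx>\<close>-related morphisms
  (\<open>inverting_W_identifies_T_equal\<close>), so \<open>L\<close> induces \<open>J\<close> on the quotient. If objects of \<open>T * \<Sigma>T\<close> are
  resolved by themselves, \<open>G\<close> after \<open>J\<close> is the identity, and the morphisms \<open>L q\<close> are the components
  of an isomorphism from \<open>J\<close> after \<open>G\<close> to the identity.

  The last point needs more than the bare universal property gives at once: the components must be
  indexed by objects of the localisation and natural for all its arrows. This follows because \<open>L\<close> is
  bijective on objects (\<open>localisation_objects\<close>, \<open>localisation_injective_on_objects\<close>) and because the
  localisation is generated by the image of \<open>L\<close> and inverses (\<open>localisation_minimal\<close>). These
  arguments apply the universal property only to categories whose objects and arrows have the types
  of \<open>C\<close> or of the localisation: to a subcategory of the localisation, to the category of zero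
  morphisms of \<open>C\<close>, and to the quotient with every congruence class replaced by a representative.
\<close>

section \<open>Isomorphisms, functors and equivalences\<close>

context category
begin

lemma Hom_objs: "f \<in> Hom C X Y \<Longrightarrow> X \<in> Obj C \<and> Y \<in> Obj C"
  using Dom_in_Obj Cod_in_Obj by (auto simp: Hom_def)

lemma Hom_Dom_Cod: "f \<in> Arr C \<Longrightarrow> f \<in> Hom C (Dom C f) (Cod C f)"
  by (simp add: Hom_def)

lemma Hom_eqs: "f \<in> Hom C X Y \<Longrightarrow> f \<in> Arr C \<and> Dom C f = X \<and> Cod C f = Y"
  by (simp add: Hom_def)

lemma is_isoI:
  assumes "f \<in> Hom C X Y" "g \<in> Hom C Y X" "g \<cdot> f = Ident C X" "f \<cdot> g = Ident C Y"
  shows "is_iso C f"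
  using assms unfolding is_iso_def by (auto simp: Hom_def)

lemma is_isoE:
  assumes "is_iso C f" "f \<in> Hom C X Y"
  obtains g where "g \<in> Hom C Y X" "g \<cdot> f = Ident C X" "f \<cdot> g = Ident C Y"
  using assms unfolding is_iso_def by (auto simp: Hom_def)

lemma is_iso_Ident: "X \<in> Obj C \<Longrightarrow> is_iso C (Ident C X)"
  using Ident_in_Hom Comp_Ident is_isoI by metis

lemma iso_left_cancel:
  assumes "is_iso C e" "e \<in> Hom C Y Z" "f \<in> Hom C X Y" "g \<in> Hom C X Y" "e \<cdot> f = e \<cdot> g"
  shows "f = g"
proof -
  obtain d where d: "d \<in> Hom C Z Y" "d \<cdot> e = Ident C Y" "e \<cdot> d = Ident C Z"
    using is_isoE assms(1,2) by blast
  have "(d \<cdot> e) \<cdot> f = (d \<cdot> e) \<cdot> g"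
    using Comp_assoc[OF assms(3,2) d(1)] Comp_assoc[OF assms(4,2) d(1)] assms(5) by simp
  then show ?thesis
    using d(2) Ident_Comp assms(3,4) by simp
qed

lemma iso_right_cancel:
  assumes "is_iso C e" "e \<in> Hom C X Y" "f \<in> Hom C Y Z" "g \<in> Hom C Y Z" "f \<cdot> e = g \<cdot> e"
  shows "f = g"
proof -
  obtain d where d: "d \<in> Hom C Y X" "d \<cdot> e = Ident C X" "e \<cdot> d = Ident C Y"
    using is_isoE assms(1,2) by blast
  have "f \<cdot> (e \<cdot> d) = g \<cdot> (e \<cdot> d)"
    using Comp_assoc[OF d(1) assms(2,3)] Comp_assoc[OF d(1) assms(2,4)] assms(5) by simp
  then show ?thesis
    using d(3) Comp_Ident assms(3,4) by simp
qed

end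

lemma cat_functor_comp:
  assumes "cat_functor C D F" "cat_functor D E G"
  shows "cat_functor C E (G \<circ>\<^sub>F F)"
proof -
  interpret F: cat_functor C D F by fact
  interpret G: cat_functor D E G by fact
  show ?thesis
    by unfold_locales
      (auto simp: comp_functor_def F.omap_in_Obj G.omap_in_Obj F.amap_Ident G.amap_Ident
        intro: F.amap_in_Hom G.amap_in_Hom, metis F.amap_in_Hom F.amap_Comp G.amap_Comp)
qed

lemma cat_functor_id: "category C \<Longrightarrow> cat_functor C C id_functor"
  by (simp add: cat_functor_def cat_functor_axioms_def id_functor_def)

lemma (in cat_functor) preserves_iso:
  assumes "is_iso C f" "f \<in> Hom C X Y"
  shows "is_iso D (amap F f)"
proof -
  obtain g where g: "g \<in> Hom C Y X" "g \<cdot>\<^bsub>C\<^esub> f = Ident C X" "f \<cdot>\<^bsub>C\<^esub> g = Ident C Y"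
    using dom.is_isoE assms by blast
  show ?thesis
  proof (rule cod.is_isoI)
    show "amap F g \<cdot>\<^bsub>D\<^esub> amap F f = Ident D (omap F X)"
      using amap_Comp[OF assms(2) g(1)] g(2) amap_Ident dom.Hom_objs[OF g(1)] by simp
    show "amap F f \<cdot>\<^bsub>D\<^esub> amap F g = Ident D (omap F Y)"
      using amap_Comp[OF g(1) assms(2)] g(3) amap_Ident dom.Hom_objs[OF g(1)] by simp
  qed (use amap_in_Hom assms g in auto)
qed

text \<open>The component of the natural isomorphism at the codomain can be cancelled.\<close>

lemma faithful_if_isomorphic_to_id:
  assumes "naturally_isomorphic C C id_functor H"
    and m: "m \<in> Hom C X Y" "m' \<in> Hom C X Y" and eq: "amap H m = amap H m'"
  shows "m = m'"
proof -
  obtain \<eta> where iso: "\<And>X. X \<in> Obj C \<Longrightarrow> \<eta> X \<in> Hom C X (omap H X) \<and> is_iso C (\<eta> X)"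
    and nat: "\<And>f. f \<in> Arr C \<Longrightarrow> \<eta> (Cod C f) \<cdot>\<^bsub>C\<^esub> f = amap H f \<cdot>\<^bsub>C\<^esub> \<eta> (Dom C f)"
    and "cat_functor C C H"
    using assms(1) unfolding naturally_isomorphic_def id_functor_def by auto
  then interpret H: cat_functor C C H by simp
  have "\<eta> Y \<cdot>\<^bsub>C\<^esub> m = \<eta> Y \<cdot>\<^bsub>C\<^esub> m'"
    using nat[of m] nat[of m'] m eq by (auto simp: Hom_def)
  then show ?thesis
    using H.dom.iso_left_cancel iso H.dom.Hom_objs[OF m(1)] m by metis
qed

lemma equivalence_faithful:
  assumes "equivalence_functor C D F" "m \<in> Hom C X Y" "m' \<in> Hom C X Y" "amap F m = amap F m'"
  shows "m = m'"
proof -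
  obtain G where "naturally_isomorphic C C id_functor (G \<circ>\<^sub>F F)"
    using assms(1) unfolding equivalence_functor_def by blast
  then show ?thesis
    using faithful_if_isomorphic_to_id assms by (metis comp_apply comp_functor_def funct.select_convs(2))
qed

text \<open>The preimage is the only possible one: it must become \<open>G k\<close> under the isomorphisms \<open>\<eta>\<close> from the
  identity to \<open>G F\<close>, and \<open>G\<close>, itself faithful, then shows that it maps to \<open>k\<close>.\<close>

lemma equivalence_full:
  assumes "equivalence_functor C D F" and X: "X \<in> Obj C" and Y: "Y \<in> Obj C"
    and k: "k \<in> Hom D (omap F X) (omap F Y)"
  obtains m where "m \<in> Hom C X Y" "amap F m = k"
proof -
  obtain G where F: "cat_functor C D F" and G: "cat_functor D C G"
    and GF: "naturally_isomorphic C C id_functor (G \<circ>\<^sub>F F)"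
    and FG: "naturally_isomorphic D D id_functor (F \<circ>\<^sub>F G)"
    using assms(1) unfolding equivalence_functor_def by blast
  interpret F: cat_functor C D F by fact
  interpret G: cat_functor D C G by fact
  obtain \<eta> where
      iso: "\<And>X. X \<in> Obj C \<Longrightarrow> \<eta> X \<in> Hom C X (omap G (omap F X)) \<and> is_iso C (\<eta> X)"
    and nat: "\<And>f. f \<in> Arr C \<Longrightarrow> \<eta> (Cod C f) \<cdot>\<^bsub>C\<^esub> f = amap G (amap F f) \<cdot>\<^bsub>C\<^esub> \<eta> (Dom C f)"
    using GF unfolding naturally_isomorphic_def id_functor_def comp_functor_def by auto
  obtain d where d: "d \<in> Hom C (omap G (omap F Y)) Y" "\<eta> Y \<cdot>\<^bsub>C\<^esub> d = Ident C (omap G (omap F Y))"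
    using F.dom.is_isoE iso[OF Y] by metis
  note Gk = G.amap_in_Hom[OF k]
  have Gk\<eta>: "amap G k \<cdot>\<^bsub>C\<^esub> \<eta> X \<in> Hom C X (omap G (omap F Y))"
    using F.dom.Comp_in_Hom iso[OF X] Gk by blast
  define m where "m = d \<cdot>\<^bsub>C\<^esub> (amap G k \<cdot>\<^bsub>C\<^esub> \<eta> X)"
  have m: "m \<in> Hom C X Y"
    unfolding m_def using F.dom.Comp_in_Hom Gk\<eta> d(1) by blast
  have "\<eta> Y \<cdot>\<^bsub>C\<^esub> m = amap G k \<cdot>\<^bsub>C\<^esub> \<eta> X"
    unfolding m_def using F.dom.Comp_assoc[OF Gk\<eta> d(1)] iso[OF Y] d(2) F.dom.Ident_Comp[OF Gk\<eta>]
    by metis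
  then have "amap G (amap F m) \<cdot>\<^bsub>C\<^esub> \<eta> X = amap G k \<cdot>\<^bsub>C\<^esub> \<eta> X"
    using nat[of m] m by (simp add: Hom_def)
  then have "amap G (amap F m) = amap G k"
    using F.dom.iso_right_cancel iso[OF X] G.amap_in_Hom[OF F.amap_in_Hom[OF m]] Gk by blast
  then have "amap F m = k"
    using faithful_if_isomorphic_to_id[OF FG F.amap_in_Hom[OF m] k] by (simp add: comp_functor_def)
  with m that show thesis by blast
qed

lemma equivalence_essentially_surjective:
  assumes "equivalence_functor C D F" "P \<in> Obj D"
  obtains X e where "X \<in> Obj C" "e \<in> Hom D P (omap F X)" "is_iso D e"
proof -
  obtain G where "cat_functor D C G" "naturally_isomorphic D D id_functor (F \<circ>\<^sub>F G)"
    using assms(1) unfolding equivalence_functor_def by blast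
  then show thesis
    using that assms(2) cat_functor.omap_in_Obj
    unfolding naturally_isomorphic_def id_functor_def comp_functor_def by fastforce
qed


section \<open>Consequences of the universal property of a localisation\<close>

text \<open>A subcategory of the localisation that contains the image of \<open>L\<close> and is closed under inverses
  is everything: \<open>L\<close> factors through it and still inverts \<open>W\<close> there, so by uniqueness the identity of
  the localisation factors through it as well.\<close>

lemma localisation_minimal:
  fixes Loc :: "('p, 'b) cat" and L :: "('o, 'a, 'p, 'b) funct"
  assumes loc: "is_localisation C W Loc L" and W: "W \<subseteq> Arr C"
    and A: "A \<subseteq> Arr Loc"
    and image: "\<And>f. f \<in> Arr C \<Longrightarrow> amap L f \<in> A"
    and comp: "\<And>f g X Y Z. \<lbrakk>f \<in> A; g \<in> A; f \<in> Hom Loc X Y; g \<in> Hom Loc Y Z\<rbrakk> \<Longrightarrow> g \<cdot>\<^bsub>Loc\<^esub> f \<in> A"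
    and inverse: "\<And>f g X Y. \<lbrakk>f \<in> A; f \<in> Hom Loc X Y; g \<in> Hom Loc Y X;
      g \<cdot>\<^bsub>Loc\<^esub> f = Ident Loc X; f \<cdot>\<^bsub>Loc\<^esub> g = Ident Loc Y\<rbrakk> \<Longrightarrow> g \<in> A"
  shows "Obj Loc = omap L ` Obj C" and "Arr Loc = A"
proof -
  interpret L: cat_functor C Loc L
    using loc unfolding is_localisation_def by blast
  let ?O = "omap L ` Obj C"
  define D :: "('p, 'b) cat" where
    "D = \<lparr>Obj = ?O, Arr = {k \<in> A. Dom Loc k \<in> ?O \<and> Cod Loc k \<in> ?O}, Dom = Dom Loc,
       Cod = Cod Loc, Ident = Ident Loc, Comp = Comp Loc\<rparr>"
  have Hom_D: "Hom D X Y = {k \<in> A. k \<in> Hom Loc X Y \<and> X \<in> ?O \<and> Y \<in> ?O}" for X Y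
    using A by (auto simp: D_def Hom_def)
  have O: "?O \<subseteq> Obj Loc"
    using L.omap_in_Obj by auto
  have image_Hom: "amap L f \<in> Hom D (omap L X) (omap L Y)" if "f \<in> Hom C X Y" for f X Y
    using L.amap_in_Hom[OF that] image L.dom.Hom_objs[OF that] L.dom.Hom_eqs[OF that] Hom_D by auto
  have cat: "category D"
  proof
    show "Ident D X \<in> Hom D X X" if X: "X \<in> Obj D" for X
    proof -
      obtain X' where "X' \<in> Obj C" "X = omap L X'"
        using X by (auto simp: D_def)
      then show ?thesis
        using image_Hom[OF L.dom.Ident_in_Hom] L.amap_Ident by (simp add: D_def)
    qed
    show "g \<cdot>\<^bsub>D\<^esub> f \<in> Hom D X Z" if "f \<in> Hom D X Y" "g \<in> Hom D Y Z" for f g X Y Z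
      using that comp L.cod.Comp_in_Hom by (auto simp: Hom_D) (auto simp: D_def)
    show "(h \<cdot>\<^bsub>D\<^esub> g) \<cdot>\<^bsub>D\<^esub> f = h \<cdot>\<^bsub>D\<^esub> (g \<cdot>\<^bsub>D\<^esub> f)"
      if "f \<in> Hom D X Y" "g \<in> Hom D Y Z" "h \<in> Hom D Z V" for f g h X Y Z V
      using that L.cod.Comp_assoc by (auto simp: Hom_D) (auto simp: D_def)
    show "f \<cdot>\<^bsub>D\<^esub> Ident D X = f" if "f \<in> Hom D X Y" for f X Y
      using that L.cod.Comp_Ident by (auto simp: Hom_D) (auto simp: D_def)
    show "Ident D Y \<cdot>\<^bsub>D\<^esub> f = f" if "f \<in> Hom D X Y" for f X Y
      using that L.cod.Ident_Comp by (auto simp: Hom_D) (auto simp: D_def)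
  qed (auto simp: D_def)
  interpret D: category D by fact
  have LD: "cat_functor C D L"
    using L.dom.category_axioms cat
    by (auto simp: cat_functor_def cat_functor_axioms_def image_Hom L.amap_Ident L.amap_Comp)
      (auto simp: D_def L.amap_Ident L.amap_Comp)
  have "inverts W D L"
    unfolding inverts_def
  proof
    fix w assume w: "w \<in> W"
    let ?X = "omap L (Dom C w)" and ?Y = "omap L (Cod C w)"
    have w': "w \<in> Hom C (Dom C w) (Cod C w)"
      using w W by (auto simp: Hom_def)
    have Lw: "amap L w \<in> Hom Loc ?X ?Y" and iso: "is_iso Loc (amap L w)"
      using L.amap_in_Hom[OF w'] loc w by (auto simp: is_localisation_def inverts_def)
    obtain g where g: "g \<in> Hom Loc ?Y ?X" "g \<cdot>\<^bsub>Loc\<^esub> amap L w = Ident Loc ?X"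
        "amap L w \<cdot>\<^bsub>Loc\<^esub> g = Ident Loc ?Y"
      using L.cod.is_isoE[OF iso Lw] by blast
    have "g \<in> A"
      using inverse Lw g image w W by blast
    then have "g \<in> Hom D ?Y ?X"
      using g L.dom.Hom_objs[OF w'] by (simp add: Hom_D)
    then show "is_iso D (amap L w)"
      using D.is_isoI[OF image_Hom[OF w']] g by (simp add: D_def)
  qed
  then obtain G where G: "cat_functor Loc D G" "functor_eq C L (G \<circ>\<^sub>F L)"
    using loc LD unfolding is_localisation_def universal_for_def by blast
  have incl: "cat_functor D Loc id_functor"
    using L.cod.category_axioms cat O
    by (auto simp: cat_functor_def cat_functor_axioms_def id_functor_def Hom_D)
      (auto simp: D_def)
  have "cat_functor Loc Loc (id_functor \<circ>\<^sub>F G)" "functor_eq C L ((id_functor \<circ>\<^sub>F G) \<circ>\<^sub>F L)"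
    "cat_functor Loc Loc id_functor" "functor_eq C L (id_functor \<circ>\<^sub>F L)"
    using cat_functor_comp[OF G(1) incl] cat_functor_id[OF L.cod.category_axioms] G(2)
    by (auto simp: functor_eq_def comp_functor_def id_functor_def)
  moreover have univ: "universal_for C W Loc L Loc" "inverts W Loc L"
    using loc unfolding is_localisation_def by auto
  obtain H where "\<And>G'. \<lbrakk>cat_functor Loc Loc G'; functor_eq C L (G' \<circ>\<^sub>F L)\<rbrakk> \<Longrightarrow> functor_eq Loc G' H"
    using univ L.cat_functor_axioms unfolding universal_for_def by blast
  ultimately have "functor_eq Loc (id_functor \<circ>\<^sub>F G) H" "functor_eq Loc id_functor H"
    by blast+
  then have "functor_eq Loc (id_functor \<circ>\<^sub>F G) id_functor"
    by (simp add: functor_eq_def)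
  then have G_id: "\<And>X. X \<in> Obj Loc \<Longrightarrow> omap G X = X" "\<And>f. f \<in> Arr Loc \<Longrightarrow> amap G f = f"
    by (auto simp: functor_eq_def comp_functor_def id_functor_def)
  interpret G: cat_functor Loc D G by fact
  show "Obj Loc = ?O"
    using O G_id(1) G.omap_in_Obj by (auto simp: D_def)
  show "Arr Loc = A"
    using A G_id(2) G.amap_in_Hom[OF L.cod.Hom_Dom_Cod] Hom_D by force
qed

lemma localisation_objects:
  assumes "is_localisation C W Loc L" "W \<subseteq> Arr C"
  shows "Obj Loc = omap L ` Obj C"
proof (rule localisation_minimal[OF assms, of "Arr Loc"])
  interpret L: cat_functor C Loc L
    using assms(1) unfolding is_localisation_def by blast
  show "amap L f \<in> Arr Loc" if "f \<in> Arr C" for f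
    using L.amap_in_Hom[OF L.dom.Hom_Dom_Cod[OF that]] by (simp add: Hom_def)
  show "g \<cdot>\<^bsub>Loc\<^esub> f \<in> Arr Loc" if "f \<in> Hom Loc X Y" "g \<in> Hom Loc Y Z" for f g X Y Z
    using L.cod.Comp_in_Hom[OF that] by (simp add: Hom_def)
qed (auto simp: Hom_def)

text \<open>The arrows of the localisation at which a given family is natural are closed under composition
  and under inverses, so naturality can be tested on the image of \<open>L\<close>.\<close>

lemma natural_if_natural_on_image:
  assumes loc: "is_localisation C W Loc L" and W: "W \<subseteq> Arr C"
    and F: "cat_functor Loc D F" and G: "cat_functor Loc D G"
    and \<eta>: "\<And>P. P \<in> Obj Loc \<Longrightarrow> \<eta> P \<in> Hom D (omap F P) (omap G P)"
    and nat: "\<And>f X Y. f \<in> Hom C X Y \<Longrightarrow>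
      \<eta> (omap L Y) \<cdot>\<^bsub>D\<^esub> amap F (amap L f) = amap G (amap L f) \<cdot>\<^bsub>D\<^esub> \<eta> (omap L X)"
    and k: "k \<in> Arr Loc"
  shows "\<eta> (Cod Loc k) \<cdot>\<^bsub>D\<^esub> amap F k = amap G k \<cdot>\<^bsub>D\<^esub> \<eta> (Dom Loc k)"
proof -
  interpret L: cat_functor C Loc L
    using loc unfolding is_localisation_def by blast
  interpret F: cat_functor Loc D F by fact
  interpret G: cat_functor Loc D G by fact
  let ?A = "{k \<in> Arr Loc. \<eta> (Cod Loc k) \<cdot>\<^bsub>D\<^esub> amap F k = amap G k \<cdot>\<^bsub>D\<^esub> \<eta> (Dom Loc k)}"
  have A_iff: "k \<in> ?A \<longleftrightarrow> \<eta> Y \<cdot>\<^bsub>D\<^esub> amap F k = amap G k \<cdot>\<^bsub>D\<^esub> \<eta> X" if "k \<in> Hom Loc X Y" for k X Y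
    using that by (auto simp: Hom_def)
  have "Arr Loc = ?A"
  proof (rule localisation_minimal(2)[OF loc W])
    show "amap L f \<in> ?A" if "f \<in> Arr C" for f
      using A_iff[OF L.amap_in_Hom[OF L.dom.Hom_Dom_Cod[OF that]]] nat[OF L.dom.Hom_Dom_Cod[OF that]]
      by blast
  next
    fix f g X Y Z assume fg: "f \<in> ?A" "g \<in> ?A" "f \<in> Hom Loc X Y" "g \<in> Hom Loc Y Z"
    note objs = L.cod.Hom_objs[OF fg(3)] L.cod.Hom_objs[OF fg(4)]
    note homs = F.amap_in_Hom[OF fg(3)] F.amap_in_Hom[OF fg(4)]
      G.amap_in_Hom[OF fg(3)] G.amap_in_Hom[OF fg(4)]
    have \<eta>X: "\<eta> X \<in> Hom D (omap F X) (omap G X)" and \<eta>Y: "\<eta> Y \<in> Hom D (omap F Y) (omap G Y)"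
      and \<eta>Z: "\<eta> Z \<in> Hom D (omap F Z) (omap G Z)"
      using \<eta> objs by auto
    have "\<eta> Z \<cdot>\<^bsub>D\<^esub> (amap F g \<cdot>\<^bsub>D\<^esub> amap F f) = (\<eta> Z \<cdot>\<^bsub>D\<^esub> amap F g) \<cdot>\<^bsub>D\<^esub> amap F f"
      using F.cod.Comp_assoc[OF homs(1,2) \<eta>Z] by simp
    also have "\<dots> = (amap G g \<cdot>\<^bsub>D\<^esub> \<eta> Y) \<cdot>\<^bsub>D\<^esub> amap F f"
      using A_iff[OF fg(4)] fg(2) by simp
    also have "\<dots> = amap G g \<cdot>\<^bsub>D\<^esub> (\<eta> Y \<cdot>\<^bsub>D\<^esub> amap F f)"
      using F.cod.Comp_assoc[OF homs(1) \<eta>Y homs(4)] by simp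
    also have "\<dots> = amap G g \<cdot>\<^bsub>D\<^esub> (amap G f \<cdot>\<^bsub>D\<^esub> \<eta> X)"
      using A_iff[OF fg(3)] fg(1) by simp
    also have "\<dots> = (amap G g \<cdot>\<^bsub>D\<^esub> amap G f) \<cdot>\<^bsub>D\<^esub> \<eta> X"
      using F.cod.Comp_assoc[OF \<eta>X homs(3,4)] by simp
    finally show "g \<cdot>\<^bsub>Loc\<^esub> f \<in> ?A"
      using A_iff[OF L.cod.Comp_in_Hom[OF fg(3,4)]] F.amap_Comp[OF fg(3,4)] G.amap_Comp[OF fg(3,4)]
      by simp
  next
    fix f g X Y
    assume f: "f \<in> ?A" "f \<in> Hom Loc X Y" and g: "g \<in> Hom Loc Y X"
      and gf: "g \<cdot>\<^bsub>Loc\<^esub> f = Ident Loc X" and fg: "f \<cdot>\<^bsub>Loc\<^esub> g = Ident Loc Y"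
    have objs: "X \<in> Obj Loc" "Y \<in> Obj Loc"
      using L.cod.Hom_objs[OF g] by auto
    note homs = F.amap_in_Hom[OF g] F.amap_in_Hom[OF f(2)] G.amap_in_Hom[OF g]
      G.amap_in_Hom[OF f(2)] \<eta>[OF objs(1)] \<eta>[OF objs(2)]
    have G1: "amap G g \<cdot>\<^bsub>D\<^esub> amap G f = Ident D (omap G X)"
      using G.amap_Comp[OF f(2) g] gf G.amap_Ident objs by simp
    have F1: "amap F f \<cdot>\<^bsub>D\<^esub> amap F g = Ident D (omap F Y)"
      using F.amap_Comp[OF g f(2)] fg F.amap_Ident objs by simp
    have \<eta>F: "\<eta> X \<cdot>\<^bsub>D\<^esub> amap F g \<in> Hom D (omap F Y) (omap G X)"
      using F.cod.Comp_in_Hom homs by blast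
    have "\<eta> X \<cdot>\<^bsub>D\<^esub> amap F g = (amap G g \<cdot>\<^bsub>D\<^esub> amap G f) \<cdot>\<^bsub>D\<^esub> (\<eta> X \<cdot>\<^bsub>D\<^esub> amap F g)"
      using G1 F.cod.Ident_Comp[OF \<eta>F] by simp
    also have "\<dots> = amap G g \<cdot>\<^bsub>D\<^esub> ((amap G f \<cdot>\<^bsub>D\<^esub> \<eta> X) \<cdot>\<^bsub>D\<^esub> amap F g)"
      using F.cod.Comp_assoc[OF \<eta>F homs(4,3)] F.cod.Comp_assoc[OF homs(1,5,4)] by simp
    also have "\<dots> = amap G g \<cdot>\<^bsub>D\<^esub> ((\<eta> Y \<cdot>\<^bsub>D\<^esub> amap F f) \<cdot>\<^bsub>D\<^esub> amap F g)"
      using A_iff[OF f(2)] f(1) by simp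
    also have "\<dots> = amap G g \<cdot>\<^bsub>D\<^esub> \<eta> Y"
      using F.cod.Comp_assoc[OF homs(1,2,6)] F1 F.cod.Comp_Ident[OF homs(6)] by simp
    finally show "g \<in> ?A"
      using A_iff[OF g] by simp
  qed auto
  then show ?thesis
    using k by blast
qed

text \<open>Renaming the arrows of \<open>E\<close> along an injection gives an isomorphic category, so a universal
  property that is known for categories with arrows of type \<open>'a\<close> holds for \<open>E\<close> as well.\<close>

lemma universal_property_renaming_arrows:
  fixes E :: "('o, 'e) cat" and r :: "'e \<Rightarrow> 'a"
  assumes univ: "\<And>D :: ('o, 'a) cat. universal_for C W Loc L D"
    and W: "W \<subseteq> Arr C"
    and F: "cat_functor C E F" "inverts W E F" and inj: "inj_on r (Arr E)"
  obtains G where "cat_functor Loc E G" "functor_eq C F (G \<circ>\<^sub>F L)"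
proof -
  interpret F: cat_functor C E F by fact
  define s where "s = inv_into (Arr E) r"
  have s: "\<And>f. f \<in> Arr E \<Longrightarrow> s (r f) = f"
    using inj by (simp add: s_def)
  define D :: "('o, 'a) cat" where
    "D = \<lparr>Obj = Obj E, Arr = r ` Arr E, Dom = Dom E \<circ> s, Cod = Cod E \<circ> s,
       Ident = r \<circ> Ident E, Comp = \<lambda>g f. r (s g \<cdot>\<^bsub>E\<^esub> s f)\<rparr>"
  have Hom_D: "Hom D X Y = r ` Hom E X Y" for X Y
    using s by (auto simp: D_def Hom_def)
  have s': "s (r f) = f" if "f \<in> Hom E X Y" for f X Y
    using that s by (simp add: Hom_def)
  have Comp_D: "r g \<cdot>\<^bsub>D\<^esub> r f = r (g \<cdot>\<^bsub>E\<^esub> f)" if "f \<in> Hom E X Y" "g \<in> Hom E Y Z" for f g X Y Z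
    using that s' by (simp add: D_def)
  have Ident_D: "Ident D X = r (Ident E X)" for X
    by (simp add: D_def)
  have cat: "category D"
  proof
    show "Ident D X \<in> Hom D X X" if "X \<in> Obj D" for X
      using that F.cod.Ident_in_Hom Hom_D by (simp add: D_def)
    show "g \<cdot>\<^bsub>D\<^esub> f \<in> Hom D X Z" if "f \<in> Hom D X Y" "g \<in> Hom D Y Z" for f g X Y Z
      using that F.cod.Comp_in_Hom by (force simp: Hom_D Comp_D)
    show "f \<cdot>\<^bsub>D\<^esub> Ident D X = f" if f: "f \<in> Hom D X Y" for f X Y
    proof -
      obtain f' where f': "f' \<in> Hom E X Y" "f = r f'"
        using f Hom_D by auto
      then show ?thesis
        using Comp_D[OF F.cod.Ident_in_Hom f'(1)] F.cod.Comp_Ident F.cod.Hom_objs Ident_D by auto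
    qed
    show "Ident D Y \<cdot>\<^bsub>D\<^esub> f = f" if f: "f \<in> Hom D X Y" for f X Y
    proof -
      obtain f' where f': "f' \<in> Hom E X Y" "f = r f'"
        using f Hom_D by auto
      then show ?thesis
        using Comp_D[OF f'(1) F.cod.Ident_in_Hom] F.cod.Ident_Comp F.cod.Hom_objs Ident_D by auto
    qed
    show "(h \<cdot>\<^bsub>D\<^esub> g) \<cdot>\<^bsub>D\<^esub> f = h \<cdot>\<^bsub>D\<^esub> (g \<cdot>\<^bsub>D\<^esub> f)"
      if fgh: "f \<in> Hom D X Y" "g \<in> Hom D Y Z" "h \<in> Hom D Z V" for f g h X Y Z V
    proof -
      obtain f' g' h' where *: "f' \<in> Hom E X Y" "f = r f'" "g' \<in> Hom E Y Z" "g = r g'"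
          "h' \<in> Hom E Z V" "h = r h'"
        using fgh Hom_D by auto
      then show ?thesis
        using Comp_D[OF *(1) F.cod.Comp_in_Hom[OF *(3,5)]] Comp_D[OF *(3,5)] Comp_D[OF *(1,3)]
          Comp_D[OF F.cod.Comp_in_Hom[OF *(1,3)] *(5)] F.cod.Comp_assoc[OF *(1,3,5)] by simp
    qed
  qed (use s F.cod.Dom_in_Obj F.cod.Cod_in_Obj in \<open>auto simp: D_def\<close>)
  define R where "R = \<lparr>omap = \<lambda>X :: 'o. X, amap = r\<rparr>"
  define R' where "R' = \<lparr>omap = \<lambda>X :: 'o. X, amap = s\<rparr>"
  have R: "cat_functor E D R"
    using F.cod.category_axioms cat
    by (auto simp: cat_functor_def cat_functor_axioms_def R_def Hom_D Ident_D Comp_D)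
      (auto simp: D_def)
  have R': "cat_functor D E R'"
  proof -
    have "s (g \<cdot>\<^bsub>D\<^esub> f) = s g \<cdot>\<^bsub>E\<^esub> s f" if "f \<in> Hom D X Y" "g \<in> Hom D Y Z" for f g X Y Z
      using that F.cod.Comp_in_Hom by (auto simp: Hom_D) (metis Comp_D s')
    moreover have "s (Ident D X) = Ident E X" if "X \<in> Obj E" for X
      using s' F.cod.Ident_in_Hom[OF that] Ident_D by simp
    ultimately show ?thesis
      using F.cod.category_axioms cat s'
      by (auto simp: cat_functor_def cat_functor_axioms_def R'_def Hom_D) (auto simp: D_def)
  qed
  have "inverts W D (R \<circ>\<^sub>F F)"
    unfolding inverts_def
  proof
    fix w assume w: "w \<in> W"
    then have "is_iso E (amap F w)" "amap F w \<in> Hom E (omap F (Dom C w)) (omap F (Cod C w))"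
      using F(2) W F.amap_in_Hom[OF F.dom.Hom_Dom_Cod] by (auto simp: inverts_def)
    then show "is_iso D (amap (R \<circ>\<^sub>F F) w)"
      using cat_functor.preserves_iso[OF R] by (simp add: comp_functor_def)
  qed
  then obtain G where G: "cat_functor Loc D G" "functor_eq C (R \<circ>\<^sub>F F) (G \<circ>\<^sub>F L)"
    using univ[of D] cat_functor_comp[OF F(1) R] unfolding universal_for_def by blast
  have "functor_eq C F ((R' \<circ>\<^sub>F G) \<circ>\<^sub>F L)"
    unfolding functor_eq_def
  proof safe
    show "omap F X = omap (R' \<circ>\<^sub>F G \<circ>\<^sub>F L) X" if "X \<in> Obj C" for X
      using G(2) that by (auto simp: functor_eq_def comp_functor_def R_def R'_def)
    show "amap F f = amap (R' \<circ>\<^sub>F G \<circ>\<^sub>F L) f" if "f \<in> Arr C" for f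
    proof -
      have "r (amap F f) = amap G (amap L f)"
        using G(2) that by (simp add: functor_eq_def comp_functor_def R_def)
      then show ?thesis
        using s'[OF F.amap_in_Hom[OF F.dom.Hom_Dom_Cod[OF that]]]
        by (simp add: comp_functor_def R'_def)
    qed
  qed
  then show thesis
    using that cat_functor_comp[OF G(1) R'] by blast
qed

section \<open>Preadditive categories\<close>

context preadditive_category
begin

lemma Hom_group:
  assumes "X \<in> Obj C" "Y \<in> Obj C"
  shows Zero_in_Hom: "Zero C X Y \<in> Hom C X Y"
    and Add_in_Hom: "\<lbrakk>f \<in> Hom C X Y; g \<in> Hom C X Y\<rbrakk> \<Longrightarrow> f \<boxplus> g \<in> Hom C X Y"
    and Add_assoc: "\<lbrakk>f \<in> Hom C X Y; g \<in> Hom C X Y; h \<in> Hom C X Y\<rbrakk>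
      \<Longrightarrow> (f \<boxplus> g) \<boxplus> h = f \<boxplus> (g \<boxplus> h)"
    and Add_commute: "\<lbrakk>f \<in> Hom C X Y; g \<in> Hom C X Y\<rbrakk> \<Longrightarrow> f \<boxplus> g = g \<boxplus> f"
    and Zero_Add: "f \<in> Hom C X Y \<Longrightarrow> Zero C X Y \<boxplus> f = f"
    and Add_Zero: "f \<in> Hom C X Y \<Longrightarrow> f \<boxplus> Zero C X Y = f"
    and Neg_in_Hom: "f \<in> Hom C X Y \<Longrightarrow> Neg C f \<in> Hom C X Y"
    and Add_Neg: "f \<in> Hom C X Y \<Longrightarrow> f \<boxplus> Neg C f = Zero C X Y"
    and Neg_Add: "f \<in> Hom C X Y \<Longrightarrow> Neg C f \<boxplus> f = Zero C X Y"
    and Add_eq_ZeroD: "\<lbrakk>f \<in> Hom C X Y; g \<in> Hom C X Y; f \<boxplus> g = Zero C X Y\<rbrakk> \<Longrightarrow> f = Neg C g"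
    and Add_idem: "\<lbrakk>f \<in> Hom C X Y; f \<boxplus> f = f\<rbrakk> \<Longrightarrow> f = Zero C X Y"
proof -
  interpret G: comm_group "hom_group C X Y"
    using hom_comm_group assms by blast
  have Neg: "Neg C f = inv\<^bsub>hom_group C X Y\<^esub> f" if "f \<in> Hom C X Y" for f
    using that by (simp add: Neg_def Hom_def)
  note [simp] = hom_group_def
  show "Zero C X Y \<in> Hom C X Y"
    using G.one_closed by simp
  show "\<lbrakk>f \<in> Hom C X Y; g \<in> Hom C X Y\<rbrakk> \<Longrightarrow> f \<boxplus> g \<in> Hom C X Y"
    using G.m_closed[of f g] by simp
  show "\<lbrakk>f \<in> Hom C X Y; g \<in> Hom C X Y; h \<in> Hom C X Y\<rbrakk> \<Longrightarrow> (f \<boxplus> g) \<boxplus> h = f \<boxplus> (g \<boxplus> h)"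
    using G.m_assoc[of f g h] by simp
  show "\<lbrakk>f \<in> Hom C X Y; g \<in> Hom C X Y\<rbrakk> \<Longrightarrow> f \<boxplus> g = g \<boxplus> f"
    using G.m_comm[of f g] by simp
  show "f \<in> Hom C X Y \<Longrightarrow> Zero C X Y \<boxplus> f = f"
    using G.l_one[of f] by simp
  show "f \<in> Hom C X Y \<Longrightarrow> f \<boxplus> Zero C X Y = f"
    using G.r_one[of f] by simp
  show "f \<in> Hom C X Y \<Longrightarrow> Neg C f \<in> Hom C X Y"
    using G.inv_closed[of f] Neg by simp
  show "f \<in> Hom C X Y \<Longrightarrow> f \<boxplus> Neg C f = Zero C X Y"
    using G.r_inv[of f] Neg by simp
  show "f \<in> Hom C X Y \<Longrightarrow> Neg C f \<boxplus> f = Zero C X Y"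
    using G.l_inv[of f] Neg by simp
  show "\<lbrakk>f \<in> Hom C X Y; g \<in> Hom C X Y; f \<boxplus> g = Zero C X Y\<rbrakk> \<Longrightarrow> f = Neg C g"
    using G.inv_equality[of f g] Neg by simp
  show "\<lbrakk>f \<in> Hom C X Y; f \<boxplus> f = f\<rbrakk> \<Longrightarrow> f = Zero C X Y"
    using G.r_cancel_one[of f f] by simp
qed

lemma Neg_Neg: "f \<in> Hom C X Y \<Longrightarrow> Neg C (Neg C f) = f"
  using Add_eq_ZeroD[of X Y f "Neg C f"] Add_Neg Neg_in_Hom Hom_objs by metis

lemma Neg_Zero: "\<lbrakk>X \<in> Obj C; Y \<in> Obj C\<rbrakk> \<Longrightarrow> Neg C (Zero C X Y) = Zero C X Y"
  using Add_eq_ZeroD[of X Y "Zero C X Y" "Zero C X Y"] Add_Zero Zero_in_Hom by metis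

lemma Comp_Zero:
  assumes "g \<in> Hom C Y Z" "X \<in> Obj C"
  shows "g \<cdot> Zero C X Y = Zero C X Z"
proof (rule Add_idem)
  have Y: "Y \<in> Obj C" and Z: "Z \<in> Obj C"
    using Hom_objs[OF assms(1)] by auto
  note 0 = Zero_in_Hom[OF assms(2) Y]
  show "X \<in> Obj C" "Z \<in> Obj C" "g \<cdot> Zero C X Y \<in> Hom C X Z"
    using assms Z Comp_in_Hom[OF 0] by auto
  show "(g \<cdot> Zero C X Y) \<boxplus> (g \<cdot> Zero C X Y) = g \<cdot> Zero C X Y"
    using Comp_Add[OF 0 0 assms(1)] Add_Zero[OF assms(2) Y 0] by simp
qed

lemma Zero_Comp:
  assumes "f \<in> Hom C X Y" "Z \<in> Obj C"
  shows "Zero C Y Z \<cdot> f = Zero C X Z"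
proof (rule Add_idem)
  have X: "X \<in> Obj C" and Y: "Y \<in> Obj C"
    using Hom_objs[OF assms(1)] by auto
  note 0 = Zero_in_Hom[OF Y assms(2)]
  show "X \<in> Obj C" "Z \<in> Obj C" "Zero C Y Z \<cdot> f \<in> Hom C X Z"
    using assms X Comp_in_Hom[OF assms(1) 0] by auto
  show "(Zero C Y Z \<cdot> f) \<boxplus> (Zero C Y Z \<cdot> f) = Zero C Y Z \<cdot> f"
    using Add_Comp[OF assms(1) 0 0] Add_Zero[OF Y assms(2) 0] by simp
qed

lemma Comp_Neg:
  assumes "g \<in> Hom C Y Z" "f \<in> Hom C X Y"
  shows "g \<cdot> Neg C f = Neg C (g \<cdot> f)"
proof -
  have objs: "X \<in> Obj C" "Y \<in> Obj C" "Z \<in> Obj C"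
    using Hom_objs assms by blast+
  note n = Neg_in_Hom[OF objs(1,2) assms(2)]
  show ?thesis
    using Comp_Add[OF n assms(2,1)] Neg_Add[OF objs(1,2) assms(2)] Comp_Zero[OF assms(1) objs(1)]
    by (intro Add_eq_ZeroD[OF objs(1,3)] Comp_in_Hom n assms) (auto intro: Comp_in_Hom n assms)
qed

lemma Neg_Comp:
  assumes "g \<in> Hom C Y Z" "f \<in> Hom C X Y"
  shows "Neg C g \<cdot> f = Neg C (g \<cdot> f)"
proof -
  have objs: "X \<in> Obj C" "Y \<in> Obj C" "Z \<in> Obj C"
    using Hom_objs assms by blast+
  note n = Neg_in_Hom[OF objs(2,3) assms(1)]
  show ?thesis
    using Add_Comp[OF assms(2) n assms(1)] Neg_Add[OF objs(2,3) assms(1)] Zero_Comp[OF assms(2) objs(3)]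
    by (intro Add_eq_ZeroD[OF objs(1,3)] Comp_in_Hom[OF assms(2)] n assms) auto
qed

lemma Comp_diff:
  assumes "g \<in> Hom C Y Z" "f \<in> Hom C X Y" "f' \<in> Hom C X Y"
  shows "g \<cdot> (f \<boxplus> Neg C f') = (g \<cdot> f) \<boxplus> Neg C (g \<cdot> f')"
  using Comp_Add[OF assms(2) Neg_in_Hom assms(1)] Comp_Neg[OF assms(1,3)] Hom_objs[OF assms(2)]
    assms(3) by simp

lemma diff_Comp:
  assumes "f \<in> Hom C X Y" "g \<in> Hom C Y Z" "g' \<in> Hom C Y Z"
  shows "(g \<boxplus> Neg C g') \<cdot> f = (g \<cdot> f) \<boxplus> Neg C (g' \<cdot> f)"
  using Add_Comp[OF assms(1,2) Neg_in_Hom] Neg_Comp[OF assms(3,1)] Hom_objs[OF assms(2)]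
    assms(3) by simp

lemma diff_in_Hom:
  "\<lbrakk>f \<in> Hom C X Y; g \<in> Hom C X Y\<rbrakk> \<Longrightarrow> f \<boxplus> Neg C g \<in> Hom C X Y"
  using Add_in_Hom Neg_in_Hom Hom_objs by blast

lemma diff_eq_Zero_iff:
  assumes "f \<in> Hom C X Y" "g \<in> Hom C X Y"
  shows "f \<boxplus> Neg C g = Zero C X Y \<longleftrightarrow> f = g"
  using Add_eq_ZeroD[of X Y f "Neg C g"] Add_Neg[of X Y g] Neg_Neg[OF assms(2)] Neg_in_Hom[of X Y g]
    Hom_objs[OF assms(1)] assms by metis

lemma diff_Add_cancel:
  assumes "f \<in> Hom C X Y" "g \<in> Hom C X Y"
  shows "(f \<boxplus> Neg C g) \<boxplus> g = f"
proof -
  have objs: "X \<in> Obj C" "Y \<in> Obj C"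
    using Hom_objs assms by blast+
  show ?thesis
    using Add_assoc[OF objs assms(1) Neg_in_Hom[OF objs assms(2)] assms(2)]
      Neg_Add[OF objs assms(2)] Add_Zero[OF objs assms(1)] by simp
qed

lemma zero_object_Hom:
  assumes "zero_object C O'"
  shows "f \<in> Hom C X O' \<Longrightarrow> f = Zero C X O'" and "f \<in> Hom C O' X \<Longrightarrow> f = Zero C O' X"
  using assms Zero_in_Hom Hom_objs unfolding zero_object_def by metis+

lemma zero_objectI:
  assumes "X \<in> Obj C" and "Ident C X = Zero C X X"
  shows "zero_object C X"
  unfolding zero_object_def
proof (intro conjI ballI)
  fix Y assume Y: "Y \<in> Obj C"
  have "f = Zero C Y X" if "f \<in> Hom C Y X" for f
    using Ident_Comp[OF that] Zero_Comp[OF that assms(1)] assms(2) by simp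
  then show "\<exists>!f. f \<in> Hom C Y X"
    using Zero_in_Hom[OF Y assms(1)] by blast
  have "f = Zero C X Y" if "f \<in> Hom C X Y" for f
    using Comp_Ident[OF that] Comp_Zero[OF that assms(1)] assms(2) by simp
  then show "\<exists>!f. f \<in> Hom C X Y"
    using Zero_in_Hom[OF assms(1) Y] by blast
qed (use assms in auto)

end

text \<open>The zero morphisms form a category in which every two objects are joined by exactly one arrow.
  All its arrows are isomorphisms, so the functor from \<open>C\<close> to it that fixes the objects inverts
  \<open>W\<close> and factors through \<open>L\<close>; hence \<open>L\<close> cannot identify objects.\<close>

lemma localisation_injective_on_objects:
  fixes C :: "('o, 'a, 'z) addcat_scheme"
  assumes "preadditive_category C" and loc: "is_localisation C W Loc L" and W: "W \<subseteq> Arr C"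
  shows "inj_on (omap L) (Obj C)"
proof -
  interpret preadditive_category C by fact
  define D :: "('o, 'a) cat" where
    "D = \<lparr>Obj = Obj C, Arr = {Zero C X Y | X Y. X \<in> Obj C \<and> Y \<in> Obj C}, Dom = Dom C, Cod = Cod C,
       Ident = \<lambda>X. Zero C X X, Comp = Comp C\<rparr>"
  have Hom_D: "Hom D X Y = (if X \<in> Obj C \<and> Y \<in> Obj C then {Zero C X Y} else {})" for X Y
    using Hom_eqs[OF Zero_in_Hom] by (auto simp: D_def Hom_def)
  have Comp_D: "Zero C Y Z \<cdot>\<^bsub>D\<^esub> Zero C X Y = Zero C X Z"
    if "X \<in> Obj C" "Y \<in> Obj C" "Z \<in> Obj C" for X Y Z
    using that Comp_Zero Zero_in_Hom by (simp add: D_def)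
  have D: "category D"
  proof
    show "Dom D f \<in> Obj D" "Cod D f \<in> Obj D" if "f \<in> Arr D" for f
      using that Hom_eqs[OF Zero_in_Hom] by (auto simp: D_def)
  qed (auto simp: Hom_D Comp_D split: if_splits, auto simp: D_def Comp_Zero Zero_in_Hom)
  interpret D: category D by fact
  define F :: "('o, 'a, 'o, 'a) funct" where
    "F = \<lparr>omap = \<lambda>X. X, amap = \<lambda>f. Zero C (Dom C f) (Cod C f)\<rparr>"
  have F: "cat_functor C D F"
  proof
    fix f g X Y Z assume fg: "f \<in> Hom C X Y" "g \<in> Hom C Y Z"
    then show "amap F (g \<cdot>\<^bsub>C\<^esub> f) = amap F g \<cdot>\<^bsub>D\<^esub> amap F f"
      using Comp_D Hom_eqs[OF Comp_in_Hom[OF fg]] Hom_eqs Hom_objs[OF fg(1)] Hom_objs[OF fg(2)]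
      by (simp add: F_def Hom_eqs[OF fg(1)] Hom_eqs[OF fg(2)])
  next
    show "amap F f \<in> Hom D (omap F X) (omap F Y)" if "f \<in> Hom C X Y" for f X Y
      using Hom_objs[OF that] Hom_eqs[OF that] by (simp add: F_def Hom_D)
    show "amap F (Ident C X) = Ident D (omap F X)" if "X \<in> Obj C" for X
      using Hom_eqs[OF Ident_in_Hom[OF that]] by (simp add: F_def D_def)
  qed (simp add: F_def D_def)
  have "inverts W D F"
    unfolding inverts_def
  proof
    fix w assume "w \<in> W"
    then have objs: "Dom C w \<in> Obj C" "Cod C w \<in> Obj C"
      using W Dom_in_Obj Cod_in_Obj by auto
    have "Ident D X = Zero C X X" for X
      by (simp add: D_def)
    then show "is_iso D (amap F w)"
      using objs Comp_D
      by (intro D.is_isoI[of _ "Dom C w" "Cod C w" "Zero C (Cod C w) (Dom C w)"])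
        (auto simp: Hom_D F_def)
  qed
  then obtain G where "functor_eq C F (G \<circ>\<^sub>F L)"
    using loc F unfolding is_localisation_def universal_for_def by blast
  then have "omap G (omap L X) = X" if "X \<in> Obj C" for X
    using that by (simp add: functor_eq_def comp_functor_def F_def)
  then show ?thesis
    by (metis inj_onI)
qed


section \<open>Exactness of triangles\<close>

context triangulated_category
begin

sublocale Susp: cat_functor C C "Susp C"
  using Susp_equivalence unfolding equivalence_functor_def by blast

lemma triangle_Homs:
  assumes "(u, v, w) \<in> Triangles C"
  obtains X Y Z where "u \<in> Hom C X Y" "v \<in> Hom C Y Z" "w \<in> Hom C Z (omap (Susp C) X)"
  using Triangles_candidate[OF assms] unfolding candidate_triangle_def Hom_def by auto

lemma candidateI:
  "\<lbrakk>u \<in> Hom C X Y; v \<in> Hom C Y Z; w \<in> Hom C Z (omap (Susp C) X)\<rbrakk> \<Longrightarrow> candidate_triangle C u v w"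
  unfolding candidate_triangle_def Hom_def by auto

lemma rotate:
  "(u, v, w) \<in> Triangles C \<Longrightarrow> (v, w, Neg C (amap (Susp C) u)) \<in> Triangles C"
  using TR2 Triangles_candidate by blast

lemma Susp_Zero:
  assumes "X \<in> Obj C" "Y \<in> Obj C"
  shows "amap (Susp C) (Zero C X Y) = Zero C (omap (Susp C) X) (omap (Susp C) Y)"
proof (rule Add_idem)
  note 0 = Zero_in_Hom[OF assms]
  show "amap (Susp C) (Zero C X Y) \<in> Hom C (omap (Susp C) X) (omap (Susp C) Y)"
    using Susp.amap_in_Hom[OF 0] .
  show "amap (Susp C) (Zero C X Y) \<boxplus> amap (Susp C) (Zero C X Y) = amap (Susp C) (Zero C X Y)"
    using Susp_Add[OF 0 0] Add_Zero[OF assms 0] by simp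
qed (use assms Susp.omap_in_Obj in auto)

lemma zero_object_Susp:
  assumes "zero_object C O'"
  shows "zero_object C (omap (Susp C) O')"
proof (rule zero_objectI)
  have O': "O' \<in> Obj C"
    using assms unfolding zero_object_def by blast
  then show "omap (Susp C) O' \<in> Obj C"
    using Susp.omap_in_Obj by blast
  have "Ident C O' = Zero C O' O'"
    using zero_object_Hom(1)[OF assms] Ident_in_Hom O' by blast
  then show "Ident C (omap (Susp C) O') = Zero C (omap (Susp C) O') (omap (Susp C) O')"
    using Susp.amap_Ident[OF O'] Susp_Zero[OF O' O'] by simp
qed

text \<open>The identity of \<open>X\<close> and \<open>u\<close> map the trivial triangle on \<open>X\<close> to \<open>(u, v, w)\<close>, so \<open>v \<cdot> u\<close> factors
  through a zero object.\<close>

lemma triangle_Comp_Zero: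
  assumes "(u, v, w) \<in> Triangles C" "u \<in> Hom C X Y" "v \<in> Hom C Y Z"
  shows "v \<cdot> u = Zero C X Z"
proof -
  obtain O' where O': "zero_object C O'" "O' \<in> Obj C"
    using ex_zero_object unfolding zero_object_def by blast
  have X: "X \<in> Obj C" and Z: "Z \<in> Obj C"
    using Hom_objs assms by blast+
  note 0 = Zero_in_Hom[OF X O'(2)] Zero_in_Hom[OF O'(2) Susp.omap_in_Obj[OF X]]
  note id = Ident_in_Hom[OF X]
  have w: "w \<in> Hom C Z (omap (Susp C) X)"
    using triangle_Homs[OF assms(1)] assms(2,3) by (metis Hom_eqs)
  have "\<exists>c \<in> Hom C (Dom C (Zero C O' (omap (Susp C) X))) (Dom C w).
      c \<cdot> Zero C X O' = v \<cdot> u \<and> amap (Susp C) (Ident C X) \<cdot> Zero C O' (omap (Susp C) X) = w \<cdot> c"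
    using Hom_eqs[OF assms(2)] Hom_eqs[OF assms(3)] Hom_eqs[OF 0(1)] Hom_eqs[OF id] id assms(2)
    by (intro TR3[OF TR1_Ident[OF X O'(1)] assms(1)]) auto
  then obtain c where "c \<in> Hom C O' Z" "c \<cdot> Zero C X O' = v \<cdot> u"
    using Hom_eqs[OF 0(2)] Hom_eqs[OF w] by auto
  then show ?thesis
    using Comp_Zero X by metis
qed

text \<open>A morphism \<open>k\<close> that vanishes on \<open>u\<close> extends to a morphism of triangles from \<open>(u, v, w)\<close> to
  \<open>0 \<rightarrow> A \<rightarrow> A\<close>, whose third arrow is the factorisation.\<close>

lemma triangle_factor_left:
  assumes "(u, v, w) \<in> Triangles C" "u \<in> Hom C X Y" "v \<in> Hom C Y Z"
    and k: "k \<in> Hom C Y A" "k \<cdot> u = Zero C X A"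
  obtains k' where "k' \<in> Hom C Z A" "k = k' \<cdot> v"
proof -
  obtain O' where O': "zero_object C O'" "O' \<in> Obj C"
    using ex_zero_object unfolding zero_object_def by blast
  have X: "X \<in> Obj C" and A: "A \<in> Obj C"
    using Hom_objs assms by blast+
  let ?S = "omap (Susp C)"
  have SO: "?S O' \<in> Obj C" and SA: "?S A \<in> Obj C"
    using Susp.omap_in_Obj O' A by auto
  note 0 = Zero_in_Hom[OF O'(2) A] Zero_in_Hom[OF A SO] Zero_in_Hom[OF X O'(2)]
  note id = Ident_in_Hom[OF A]
  have "Neg C (amap (Susp C) (Zero C O' A)) = Zero C (?S O') (?S A)"
    using Susp_Zero[OF O'(2) A] Neg_Zero[OF SO SA] by simp
  then have "(Ident C A, Zero C A (?S O'), Neg C (amap (Susp C) (Zero C O' A))) \<in> Triangles C"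
    using TR1_Ident[OF A zero_object_Susp[OF O'(1)]] by simp
  then have tri: "(Zero C O' A, Ident C A, Zero C A (?S O')) \<in> Triangles C"
    using TR2[OF candidateI[OF 0(1) id 0(2)]] by simp
  have w: "w \<in> Hom C Z (?S X)"
    using triangle_Homs[OF assms(1)] assms(2,3) by (metis Hom_eqs)
  have "\<exists>c \<in> Hom C (Dom C w) (Dom C (Zero C A (?S O'))).
      c \<cdot> v = Ident C A \<cdot> k \<and> amap (Susp C) (Zero C X O') \<cdot> w = Zero C A (?S O') \<cdot> c"
    using Hom_eqs[OF assms(2)] Hom_eqs[OF assms(3)] Hom_eqs[OF 0(1)] Hom_eqs[OF id] 0(3) k
      Comp_Zero[OF 0(1) X]
    by (intro TR3[OF assms(1) tri]) auto
  then obtain c where "c \<in> Hom C Z A" "c \<cdot> v = Ident C A \<cdot> k"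
    using Hom_eqs[OF 0(2)] Hom_eqs[OF w] by auto
  then show thesis
    using that Ident_Comp[OF k(1)] by metis
qed

text \<open>The square formed by \<open>t\<close> and the zero map out of a zero object extends to a morphism of
  triangles from \<open>D \<rightarrow> 0 \<rightarrow> \<Sigma>D\<close> to the rotation of \<open>(u, v, w)\<close>; the third arrow is the
  suspension of a factorisation of \<open>t\<close> through \<open>u\<close>, because the suspension is full and faithful.\<close>

lemma triangle_factor_right:
  assumes tri: "(u, v, w) \<in> Triangles C" and u: "u \<in> Hom C X Y" and v: "v \<in> Hom C Y Z"
    and t: "t \<in> Hom C D Y" "v \<cdot> t = Zero C D Z"
  obtains s where "s \<in> Hom C D X" "t = u \<cdot> s"
proof -
  obtain O' where O': "zero_object C O'" "O' \<in> Obj C"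
    using ex_zero_object unfolding zero_object_def by blast
  have D: "D \<in> Obj C" and X: "X \<in> Obj C" and Z: "Z \<in> Obj C"
    using Hom_objs t u v by blast+
  let ?S = "omap (Susp C)" and ?s = "amap (Susp C)"
  note objs = Susp.omap_in_Obj[OF D] Susp.omap_in_Obj[OF X]
  note 0 = Zero_in_Hom[OF D O'(2)] Zero_in_Hom[OF O'(2) objs(1)] Zero_in_Hom[OF O'(2) Z]
  note id = Ident_in_Hom[OF objs(1)]
  have w: "w \<in> Hom C Z (?S X)"
    using triangle_Homs[OF tri] u v by (metis Hom_eqs)
  have tri1: "(Zero C D O', Zero C O' (?S D), Neg C (Ident C (?S D))) \<in> Triangles C"
    using rotate[OF TR1_Ident[OF D O'(1)]] Susp.amap_Ident[OF D] by simp
  note n = Neg_in_Hom[OF objs(1) objs(1) id]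
  have tri2: "(v, w, Neg C (?s u)) \<in> Triangles C"
    by (rule rotate[OF tri])
  note su = Susp.amap_in_Hom[OF u]
  have Y: "?S Y \<in> Obj C"
    using Hom_objs[OF su] by blast
  note nu = Neg_in_Hom[OF objs(2) Y su]
  have "\<exists>c \<in> Hom C (Dom C (Neg C (Ident C (?S D)))) (Dom C (Neg C (?s u))).
      c \<cdot> Zero C O' (?S D) = w \<cdot> Zero C O' Z \<and> ?s t \<cdot> Neg C (Ident C (?S D)) = Neg C (?s u) \<cdot> c"
    using Hom_eqs[OF 0(1)] Hom_eqs[OF 0(2)] Hom_eqs[OF v] Hom_eqs[OF w] 0(3) t Comp_Zero[OF 0(3) D]
    by (intro TR3[OF tri1 tri2]) auto
  then obtain c where c: "c \<in> Hom C (?S D) (?S X)"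
      "?s t \<cdot> Neg C (Ident C (?S D)) = Neg C (?s u) \<cdot> c"
    using Hom_eqs[OF n] Hom_eqs[OF nu] by auto
  obtain s where s: "s \<in> Hom C D X" "?s s = c"
    using equivalence_full[OF Susp_equivalence D X c(1)] by blast
  note st = Susp.amap_in_Hom[OF t(1)]
  have "Neg C (?s t) = Neg C (?s (u \<cdot> s))"
    using c(2) Comp_Neg[OF st id] Comp_Ident[OF st] Neg_Comp[OF su c(1)] Susp.amap_Comp[OF s(1) u] s(2)
    by simp
  then have "?s t = ?s (u \<cdot> s)"
    using Neg_Neg[OF st] Neg_Neg[OF Susp.amap_in_Hom[OF Comp_in_Hom[OF s(1) u]]] by metis
  then have "t = u \<cdot> s"
    using equivalence_faithful[OF Susp_equivalence t(1) Comp_in_Hom[OF s(1) u]] by blast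
  then show thesis
    using that s(1) by blast
qed

text \<open>Since \<open>\<Sigma>\<close> is essentially surjective and full, the last arrow of a completed triangle is, up to
  isomorphism, minus the suspension of some arrow, which then precedes the first one.\<close>

lemma complete_triangle_left:
  assumes f: "f \<in> Hom C X Y"
  obtains Z u v where "u \<in> Hom C Z X" "v \<in> Hom C Y (omap (Susp C) Z)" "(u, f, v) \<in> Triangles C"
proof -
  let ?S = "omap (Susp C)" and ?s = "amap (Susp C)"
  obtain g h where tri: "(f, g, h) \<in> Triangles C"
    using TR1_complete f Hom_eqs by blast
  obtain K where g: "g \<in> Hom C Y K" and h: "h \<in> Hom C K (?S X)"
    using triangle_Homs[OF tri] Hom_eqs[OF f] by (metis Hom_eqs)
  have objs: "X \<in> Obj C" "Y \<in> Obj C" "K \<in> Obj C"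
    using Hom_objs f g by blast+
  obtain Z e where Z: "Z \<in> Obj C" and e: "e \<in> Hom C K (?S Z)" "is_iso C e"
    using equivalence_essentially_surjective[OF Susp_equivalence objs(3)] .
  obtain d where d: "d \<in> Hom C (?S Z) K" "d \<cdot> e = Ident C K" "e \<cdot> d = Ident C (?S Z)"
    using is_isoE[OF e(2,1)] .
  note hd = Comp_in_Hom[OF d(1) h]
  have SX: "?S X \<in> Obj C" and SZ: "?S Z \<in> Obj C"
    using Susp.omap_in_Obj objs Z by auto
  note nhd = Neg_in_Hom[OF SZ SX hd]
  obtain u where u: "u \<in> Hom C Z X" "?s u = Neg C (h \<cdot> d)"
    using equivalence_full[OF Susp_equivalence Z objs(1) nhd] .
  have su: "Neg C (?s u) = h \<cdot> d"
    using u(2) Neg_Neg[OF hd] by simp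
  note v = Comp_in_Hom[OF g e(1)]
  have "(f, e \<cdot> g, Neg C (?s u)) \<in> Triangles C"
  proof (rule TR1_iso[OF tri])
    show "candidate_triangle C f (e \<cdot> g) (Neg C (?s u))"
      using candidateI[OF f v] hd su by simp
    show "Ident C X \<in> Hom C (Dom C f) (Dom C f)" "Ident C Y \<in> Hom C (Dom C g) (Dom C (e \<cdot> g))"
      "e \<in> Hom C (Dom C h) (Dom C (Neg C (?s u)))"
      using Hom_eqs f g h v hd e su Ident_in_Hom objs by auto
    show "Ident C Y \<cdot> f = f \<cdot> Ident C X" "e \<cdot> g = (e \<cdot> g) \<cdot> Ident C Y"
      using Ident_Comp Comp_Ident f v by auto
    show "?s (Ident C X) \<cdot> h = Neg C (?s u) \<cdot> e"
      using Susp.amap_Ident[OF objs(1)] Ident_Comp[OF h] su Comp_assoc[OF e(1) d(1) h] d(2)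
        Comp_Ident[OF h] by simp
  qed (use is_iso_Ident objs e in auto)
  then have "(u, f, e \<cdot> g) \<in> Triangles C"
    using TR2[OF candidateI[OF u(1) f v]] by blast
  then show thesis
    using that u(1) v by blast
qed

end

section \<open>Morphisms tested on a rigid contravariantly finite subcategory\<close>

locale rigid_contravariantly_finite = triangulated_category C
  for C :: "('o, 'a, 'z) tricat_scheme" (structure) +
  fixes T :: "'o set"
  assumes T_strictly_full: "strictly_full C T"
    and T_summands: "closed_under_summands C T"
    and T_approximations: "contravariantly_finite C T"
    and T_rigid: "rigid C T"
begin

text \<open>For \<open>f, g : X \<rightarrow> Y\<close> this says that they induce the same morphism between the functors
  \<open>D \<mapsto> C(D, X)\<close> and \<open>D \<mapsto> C(D, Y)\<close> on \<open>T\<close>.\<close>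

definition T_equal :: "'a \<Rightarrow> 'a \<Rightarrow> bool"  (infix "\<approx>" 50) where
  "f \<approx> g \<longleftrightarrow> f \<in> Arr C \<and> g \<in> Hom C (Dom C f) (Cod C f) \<and>
     (\<forall>D \<in> T. \<forall>t \<in> Hom C D (Dom C f). f \<cdot> t = g \<cdot> t)"

definition T_bijective :: "'a \<Rightarrow> bool" where
  "T_bijective f \<longleftrightarrow> f \<in> Arr C \<and>
     (\<forall>D \<in> T. bij_betw (\<lambda>t. f \<cdot> t) (Hom C D (Dom C f)) (Hom C D (Cod C f)))"

abbreviation "\<S> \<equiv> T_star_Susp_T C T"
abbreviation "\<W> \<equiv> W_class C T"

lemma T_objs: "D \<in> T \<Longrightarrow> D \<in> Obj C"
  using T_strictly_full unfolding strictly_full_def by blast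

lemma Susp_T_perp: "D \<in> T \<Longrightarrow> omap (Susp C) D \<in> right_perp C T"
  using T_rigid unfolding rigid_def suspension_def by blast

lemma Hom_T_perp: "\<lbrakk>D \<in> T; K \<in> right_perp C T; f \<in> Hom C D K\<rbrakk> \<Longrightarrow> f = Zero C D K"
  unfolding right_perp_def by blast

lemma T_equal_iff:
  "\<lbrakk>f \<in> Hom C X Y; g \<in> Hom C X Y\<rbrakk> \<Longrightarrow> f \<approx> g \<longleftrightarrow> (\<forall>D \<in> T. \<forall>t \<in> Hom C D X. f \<cdot> t = g \<cdot> t)"
  unfolding T_equal_def by (auto simp: Hom_def)

lemma T_equal_refl: "f \<in> Hom C X Y \<Longrightarrow> f \<approx> f"
  using T_equal_iff by blast

lemma T_equal_sym: "f \<approx> g \<Longrightarrow> g \<approx> f"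
  unfolding T_equal_def by (auto simp: Hom_def)

lemma T_equal_trans [trans]: "\<lbrakk>f \<approx> g; g \<approx> h\<rbrakk> \<Longrightarrow> f \<approx> h"
  unfolding T_equal_def by (auto simp: Hom_def)

lemma T_equal_in_Hom: "\<lbrakk>f \<approx> g; f \<in> Hom C X Y\<rbrakk> \<Longrightarrow> g \<in> Hom C X Y"
  unfolding T_equal_def by (auto simp: Hom_def)

lemma T_equal_Comp_left:
  assumes "f \<approx> g" "f \<in> Hom C X Y" "h \<in> Hom C Y Z"
  shows "h \<cdot> f \<approx> h \<cdot> g"
proof -
  have g: "g \<in> Hom C X Y"
    using T_equal_in_Hom assms by blast
  have "(h \<cdot> f) \<cdot> t = (h \<cdot> g) \<cdot> t" if "D \<in> T" "t \<in> Hom C D X" for D t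
    using Comp_assoc[OF that(2) assms(2,3)] Comp_assoc[OF that(2) g assms(3)] that
      assms(1) T_equal_iff[OF assms(2) g] by simp
  then show ?thesis
    using T_equal_iff[OF Comp_in_Hom[OF assms(2,3)] Comp_in_Hom[OF g assms(3)]] by blast
qed

lemma T_equal_Comp_right:
  assumes "f \<approx> g" "f \<in> Hom C X Y" "h \<in> Hom C Z X"
  shows "f \<cdot> h \<approx> g \<cdot> h"
proof -
  have g: "g \<in> Hom C X Y"
    using T_equal_in_Hom assms by blast
  have "(f \<cdot> h) \<cdot> t = (g \<cdot> h) \<cdot> t" if "D \<in> T" "t \<in> Hom C D Z" for D t
    using Comp_assoc[OF that(2) assms(3,2)] Comp_assoc[OF that(2) assms(3) g] that
      assms(1) T_equal_iff[OF assms(2) g] Comp_in_Hom[OF that(2) assms(3)] by simp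
  then show ?thesis
    using T_equal_iff[OF Comp_in_Hom[OF assms(3,2)] Comp_in_Hom[OF assms(3) g]] by blast
qed

lemma T_equal_Zero_iff:
  assumes "f \<in> Hom C X Y"
  shows "f \<approx> Zero C X Y \<longleftrightarrow> (\<forall>D \<in> T. \<forall>t \<in> Hom C D X. f \<cdot> t = Zero C D Y)"
proof -
  have "X \<in> Obj C" "Y \<in> Obj C"
    using Hom_objs assms by blast+
  then show ?thesis
    using T_equal_iff[OF assms Zero_in_Hom] Zero_Comp by auto
qed

lemma T_equal_iff_diff:
  assumes "f \<in> Hom C X Y" "g \<in> Hom C X Y"
  shows "f \<approx> g \<longleftrightarrow> f \<boxplus> Neg C g \<approx> Zero C X Y"
proof -
  have "(f \<boxplus> Neg C g) \<cdot> t = Zero C D Y \<longleftrightarrow> f \<cdot> t = g \<cdot> t" if "t \<in> Hom C D X" for D t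
    using diff_Comp[OF that assms] diff_eq_Zero_iff[OF Comp_in_Hom[OF that assms(1)]
        Comp_in_Hom[OF that assms(2)]] by simp
  then show ?thesis
    using T_equal_iff[OF assms] T_equal_Zero_iff[OF diff_in_Hom[OF assms]] by blast
qed

lemma T_bijective_iff:
  assumes f: "f \<in> Hom C X Y"
  shows "T_bijective f \<longleftrightarrow>
    (\<forall>D \<in> T. \<forall>t \<in> Hom C D X. f \<cdot> t = Zero C D Y \<longrightarrow> t = Zero C D X) \<and>
    (\<forall>D \<in> T. \<forall>y \<in> Hom C D Y. \<exists>x \<in> Hom C D X. y = f \<cdot> x)" (is "_ \<longleftrightarrow> ?inj \<and> ?surj")
proof -
  have eqs: "f \<in> Arr C" "Dom C f = X" "Cod C f = Y" and X: "X \<in> Obj C"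
    using Hom_eqs[OF f] Hom_objs[OF f] by auto
  have "inj_on (\<lambda>t. f \<cdot> t) (Hom C D X) \<longleftrightarrow>
      (\<forall>t \<in> Hom C D X. f \<cdot> t = Zero C D Y \<longrightarrow> t = Zero C D X)" if D: "D \<in> T" for D
  proof
    assume inj: "inj_on (\<lambda>t. f \<cdot> t) (Hom C D X)"
    show "\<forall>t \<in> Hom C D X. f \<cdot> t = Zero C D Y \<longrightarrow> t = Zero C D X"
      using inj_onD[OF inj] Comp_Zero[OF f T_objs[OF D]] Zero_in_Hom[OF T_objs[OF D] X] by metis
  next
    assume *: "\<forall>t \<in> Hom C D X. f \<cdot> t = Zero C D Y \<longrightarrow> t = Zero C D X"
    show "inj_on (\<lambda>t. f \<cdot> t) (Hom C D X)"
    proof (rule inj_onI)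
      fix s t assume st: "s \<in> Hom C D X" "t \<in> Hom C D X" "f \<cdot> s = f \<cdot> t"
      then have "f \<cdot> (s \<boxplus> Neg C t) = Zero C D Y"
        using Comp_diff[OF f st(1,2)] diff_eq_Zero_iff[OF Comp_in_Hom[OF st(1) f] Comp_in_Hom[OF st(2) f]]
        by simp
      then show "s = t"
        using * diff_in_Hom[OF st(1,2)] diff_eq_Zero_iff[OF st(1,2)] by blast
    qed
  qed
  moreover have "(\<lambda>t. f \<cdot> t) ` Hom C D X = Hom C D Y \<longleftrightarrow>
      (\<forall>y \<in> Hom C D Y. \<exists>x \<in> Hom C D X. y = f \<cdot> x)" for D
    using Comp_in_Hom[OF _ f] by blast
  ultimately show ?thesis
    unfolding T_bijective_def bij_betw_def eqs using eqs(1) by blast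
qed

text \<open>The cone of a right approximation of the domain lies in \<open>T\<^sup>\<bottom>\<close>: maps from \<open>T\<close> into it lift to
  the domain, since \<open>T\<close> is rigid, and hence to the approximation. A morphism killed by \<open>T\<close> vanishes
  on the approximation and so factors through this cone.\<close>

lemma factor_perp_iff:
  assumes f: "f \<in> Hom C X Y"
  shows "f \<in> factor_ideal C (right_perp C T) \<longleftrightarrow> f \<approx> Zero C X Y"
proof
  assume "f \<in> factor_ideal C (right_perp C T)"
  then obtain K g h where K: "K \<in> right_perp C T" and g: "g \<in> Hom C X K" and h: "h \<in> Hom C K Y"
    and fhg: "f = h \<cdot> g"
    using Hom_eqs[OF f] unfolding factor_ideal_def by auto
  have "f \<cdot> t = Zero C D Y" if "D \<in> T" "t \<in> Hom C D X" for D t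
    using Comp_assoc[OF that(2) g h] fhg Hom_T_perp[OF that(1) K Comp_in_Hom[OF that(2) g]]
      Comp_Zero[OF h T_objs[OF that(1)]] by simp
  then show "f \<approx> Zero C X Y"
    using T_equal_Zero_iff[OF f] by blast
next
  assume f0: "f \<approx> Zero C X Y"
  have X: "X \<in> Obj C"
    using Hom_objs f by blast
  obtain D p where D: "D \<in> T" and p: "p \<in> Hom C D X"
    and app: "\<And>D' g. \<lbrakk>D' \<in> T; g \<in> Hom C D' X\<rbrakk> \<Longrightarrow> \<exists>h \<in> Hom C D' D. g = p \<cdot> h"
    using T_approximations X unfolding contravariantly_finite_def right_approximation_def by metis
  obtain w z where tri: "(p, w, z) \<in> Triangles C"
    using TR1_complete Hom_eqs[OF p] by blast
  obtain K where w: "w \<in> Hom C X K" and z: "z \<in> Hom C K (omap (Susp C) D)"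
    using triangle_Homs[OF tri] Hom_eqs[OF p] by (metis Hom_eqs)
  have K: "K \<in> Obj C"
    using Hom_objs w by blast
  have "t = Zero C D' K" if D': "D' \<in> T" and t: "t \<in> Hom C D' K" for D' t
  proof -
    have "z \<cdot> t = Zero C D' (omap (Susp C) D)"
      using Hom_T_perp[OF D' Susp_T_perp[OF D] Comp_in_Hom[OF t z]] .
    then obtain x where x: "x \<in> Hom C D' X" "t = w \<cdot> x"
      using triangle_factor_right[OF rotate[OF tri] w z t] by blast
    obtain d where d: "d \<in> Hom C D' D" "x = p \<cdot> d"
      using app[OF D' x(1)] by blast
    show ?thesis
      using x d Comp_assoc[OF d(1) p w] triangle_Comp_Zero[OF tri p w] Zero_Comp[OF d(1) K] by simp
  qed
  then have "K \<in> right_perp C T"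
    unfolding right_perp_def using K Zero_in_Hom T_objs by auto
  moreover obtain k where "k \<in> Hom C K Y" "f = k \<cdot> w"
    using triangle_factor_left[OF tri p w f] f0 T_equal_Zero_iff[OF f] D p by blast
  ultimately show "f \<in> factor_ideal C (right_perp C T)"
    using w Hom_eqs[OF f] unfolding factor_ideal_def by blast
qed

text \<open>The long exact sequence of \<open>C(D, -)\<close> turns the vanishing of \<open>C(D, u)\<close> and \<open>C(D, v)\<close> into the
  bijectivity of \<open>C(D, f)\<close>.\<close>

lemma W_iff_T_bijective: "f \<in> \<W> \<longleftrightarrow> T_bijective f"
proof
  assume fW: "f \<in> \<W>"
  then obtain X Y where f: "f \<in> Hom C X Y"
    unfolding W_class_def using Hom_Dom_Cod by blast
  have objs: "X \<in> Obj C" "Y \<in> Obj C"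
    using Hom_objs[OF f] by auto
  obtain Z u v where u: "u \<in> Hom C Z X" and v: "v \<in> Hom C Y (omap (Susp C) Z)"
    and tri: "(u, f, v) \<in> Triangles C"
    using complete_triangle_left[OF f] .
  have u0: "u \<approx> Zero C Z X" and v0: "v \<approx> Zero C Y (omap (Susp C) Z)"
    using fW tri factor_perp_iff[OF u] factor_perp_iff[OF v] unfolding W_class_def by blast+
  show "T_bijective f"
    unfolding T_bijective_iff[OF f]
  proof (intro conjI ballI impI)
    fix D t assume "D \<in> T" "t \<in> Hom C D X" "f \<cdot> t = Zero C D Y"
    then show "t = Zero C D X"
      using triangle_factor_right[OF tri u f] u0 T_equal_Zero_iff[OF u] by metis
  next
    fix D y assume "D \<in> T" "y \<in> Hom C D Y"
    then show "\<exists>x \<in> Hom C D X. y = f \<cdot> x"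
      using triangle_factor_right[OF rotate[OF tri] f v] v0 T_equal_Zero_iff[OF v] by metis
  qed
next
  assume bij: "T_bijective f"
  then obtain X Y where f: "f \<in> Hom C X Y"
    unfolding T_bijective_def using Hom_Dom_Cod by blast
  have inj: "\<And>D t. \<lbrakk>D \<in> T; t \<in> Hom C D X; f \<cdot> t = Zero C D Y\<rbrakk> \<Longrightarrow> t = Zero C D X"
    and surj: "\<And>D y. \<lbrakk>D \<in> T; y \<in> Hom C D Y\<rbrakk> \<Longrightarrow> \<exists>x \<in> Hom C D X. y = f \<cdot> x"
    using bij T_bijective_iff[OF f] by blast+
  have "u \<in> factor_ideal C (right_perp C T) \<and> v \<in> factor_ideal C (right_perp C T)"
    if tri: "(u, f, v) \<in> Triangles C" for u v
  proof -
    obtain Z where u: "u \<in> Hom C Z X" and v: "v \<in> Hom C Y (omap (Susp C) Z)"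
      using triangle_Homs[OF tri] Hom_eqs[OF f] by (metis Hom_eqs)
    have Y: "Y \<in> Obj C" and SZ: "omap (Susp C) Z \<in> Obj C"
      using Hom_objs v by auto
    have "u \<cdot> t = Zero C D X" if t: "D \<in> T" "t \<in> Hom C D Z" for D t
      using inj[OF t(1) Comp_in_Hom[OF t(2) u]] Comp_assoc[OF t(2) u f] triangle_Comp_Zero[OF tri u f]
        Zero_Comp[OF t(2) Y] by simp
    moreover have "v \<cdot> y = Zero C D (omap (Susp C) Z)" if y: "D \<in> T" "y \<in> Hom C D Y" for D y
    proof -
      obtain x where x: "x \<in> Hom C D X" "y = f \<cdot> x"
        using surj[OF y] by blast
      then show ?thesis
        using Comp_assoc[OF x(1) f v] triangle_Comp_Zero[OF rotate[OF tri] f v]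
          Zero_Comp[OF x(1) SZ] by simp
    qed
    ultimately show ?thesis
      using factor_perp_iff[OF u] factor_perp_iff[OF v] T_equal_Zero_iff[OF u] T_equal_Zero_iff[OF v]
      by blast
  qed
  then show "f \<in> \<W>"
    unfolding W_class_def using Hom_eqs[OF f] by blast
qed

lemma W_subset: "\<W> \<subseteq> Arr C"
  unfolding W_class_def by blast

lemma W_injective:
  assumes "f \<in> \<W>" "f \<in> Hom C X Y" "D \<in> T" "s \<in> Hom C D X" "t \<in> Hom C D X" "f \<cdot> s = f \<cdot> t"
  shows "s = t"
  using assms Hom_eqs[OF assms(2)] unfolding W_iff_T_bijective T_bijective_def bij_betw_def inj_on_def
  by blast

lemma W_surjective:
  assumes "f \<in> \<W>" "f \<in> Hom C X Y" "D \<in> T" "y \<in> Hom C D Y"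
  obtains x where "x \<in> Hom C D X" "y = f \<cdot> x"
  using assms W_iff_T_bijective T_bijective_iff[OF assms(2)] by blast

lemma Ident_in_W: "X \<in> Obj C \<Longrightarrow> Ident C X \<in> \<W>"
  using T_bijective_iff[OF Ident_in_Hom] W_iff_T_bijective Ident_Comp by metis

lemma W_left_cancel:
  assumes "f \<in> \<W>" "f \<in> Hom C X Y" "h \<in> Hom C Z X" "h' \<in> Hom C Z X" "f \<cdot> h \<approx> f \<cdot> h'"
  shows "h \<approx> h'"
proof -
  have "h \<cdot> t = h' \<cdot> t" if t: "D \<in> T" "t \<in> Hom C D Z" for D t
  proof (rule W_injective[OF assms(1,2) t(1)])
    show "f \<cdot> (h \<cdot> t) = f \<cdot> (h' \<cdot> t)"
      using assms(5) t T_equal_iff[OF Comp_in_Hom[OF assms(3,2)] Comp_in_Hom[OF assms(4,2)]]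
        Comp_assoc[OF t(2) assms(3,2)] Comp_assoc[OF t(2) assms(4,2)] by simp
  qed (use Comp_in_Hom t assms in blast)+
  then show ?thesis
    using T_equal_iff assms(3,4) by blast
qed

text \<open>Adding to \<open>X\<close> a summand \<open>K\<close> from \<open>T\<^sup>\<bottom>\<close> yields a projection \<open>X \<oplus> K \<rightarrow> X\<close> in \<open>\<W>\<close>. Two morphisms
  whose difference factors through \<open>K\<close> are obtained from one morphism out of \<open>X \<oplus> K\<close> by composing
  with two sections of that projection, and a functor inverting the projection identifies its
  sections.\<close>

lemma inverting_W_identifies_T_equal:
  assumes F: "cat_functor C D F" "inverts \<W> D F" and fg: "f \<approx> g"
  shows "amap F f = amap F g"
proof -
  interpret F: cat_functor C D F by fact
  obtain X Y where f: "f \<in> Hom C X Y" and g: "g \<in> Hom C X Y"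
    using fg Hom_Dom_Cod unfolding T_equal_def by blast
  have "f \<boxplus> Neg C g \<in> factor_ideal C (right_perp C T)"
    using factor_perp_iff[OF diff_in_Hom[OF f g]] T_equal_iff_diff[OF f g] fg by blast
  then obtain K k h where K: "K \<in> right_perp C T" and k: "k \<in> Hom C X K" and h: "h \<in> Hom C K Y"
    and hk: "f \<boxplus> Neg C g = h \<cdot> k"
    using Hom_eqs[OF diff_in_Hom[OF f g]] unfolding factor_ideal_def by auto
  have X: "X \<in> Obj C" and Y: "Y \<in> Obj C" and K': "K \<in> Obj C"
    using Hom_objs f k by blast+
  obtain S i\<^sub>1 i\<^sub>2 p\<^sub>1 p\<^sub>2 where bip: "biproduct C X K S i\<^sub>1 i\<^sub>2 p\<^sub>1 p\<^sub>2"
    using ex_biproduct[OF X K'] by blast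
  then have S: "S \<in> Obj C" and i1: "i\<^sub>1 \<in> Hom C X S" and i2: "i\<^sub>2 \<in> Hom C K S"
    and p1: "p\<^sub>1 \<in> Hom C S X" and p2: "p\<^sub>2 \<in> Hom C S K"
    and p1i1: "p\<^sub>1 \<cdot> i\<^sub>1 = Ident C X" and p2i2: "p\<^sub>2 \<cdot> i\<^sub>2 = Ident C K"
    and p2i1: "p\<^sub>2 \<cdot> i\<^sub>1 = Zero C X K" and p1i2: "p\<^sub>1 \<cdot> i\<^sub>2 = Zero C K X"
    and sum: "(i\<^sub>1 \<cdot> p\<^sub>1) \<boxplus> (i\<^sub>2 \<cdot> p\<^sub>2) = Ident C S"
    unfolding biproduct_def by auto
  \<comment> \<open>\<open>C(E, K) = 0\<close> for \<open>E\<close> in \<open>T\<close>, so on \<open>T\<close> the object \<open>S\<close> looks like \<open>X\<close>.\<close>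
  have "T_bijective p\<^sub>1"
    unfolding T_bijective_iff[OF p1]
  proof (intro conjI ballI impI)
    fix E t assume E: "E \<in> T" and t: "t \<in> Hom C E S" and p1t: "p\<^sub>1 \<cdot> t = Zero C E X"
    have "p\<^sub>2 \<cdot> t = Zero C E K"
      using Hom_T_perp[OF E K Comp_in_Hom[OF t p2]] .
    then have "((i\<^sub>1 \<cdot> p\<^sub>1) \<boxplus> (i\<^sub>2 \<cdot> p\<^sub>2)) \<cdot> t = Zero C E S \<boxplus> Zero C E S"
      using Add_Comp[OF t Comp_in_Hom[OF p1 i1] Comp_in_Hom[OF p2 i2]] Comp_assoc[OF t p1 i1]
        Comp_assoc[OF t p2 i2] p1t Comp_Zero[OF i1 T_objs[OF E]] Comp_Zero[OF i2 T_objs[OF E]] by simp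
    then show "t = Zero C E S"
      using sum Ident_Comp[OF t] Add_Zero[OF T_objs[OF E] S Zero_in_Hom[OF T_objs[OF E] S]] by simp
  next
    fix E y assume "E \<in> T" and y: "y \<in> Hom C E X"
    have "y = p\<^sub>1 \<cdot> (i\<^sub>1 \<cdot> y)"
      using Comp_assoc[OF y i1 p1] p1i1 Ident_Comp[OF y] by simp
    then show "\<exists>x \<in> Hom C E S. y = p\<^sub>1 \<cdot> x"
      using Comp_in_Hom[OF y i1] by blast
  qed
  then have iso: "is_iso D (amap F p\<^sub>1)"
    using F(2) W_iff_T_bijective unfolding inverts_def by blast
  note i2k = Comp_in_Hom[OF k i2] and gp1 = Comp_in_Hom[OF p1 g] and hp2 = Comp_in_Hom[OF p2 h]
  define a where "a = i\<^sub>1 \<boxplus> (i\<^sub>2 \<cdot> k)"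
  define c where "c = (g \<cdot> p\<^sub>1) \<boxplus> (h \<cdot> p\<^sub>2)"
  have a: "a \<in> Hom C X S" and c: "c \<in> Hom C S Y"
    unfolding a_def c_def using Add_in_Hom S X Y i1 i2k gp1 hp2 by blast+
  have "p\<^sub>1 \<cdot> a = p\<^sub>1 \<cdot> i\<^sub>1"
    unfolding a_def using Comp_Add[OF i1 i2k p1] Comp_assoc[OF k i2 p1] p1i2 p1i1 Zero_Comp[OF k X]
      Add_Zero[OF X X Ident_in_Hom[OF X]] by simp
  then have "amap F p\<^sub>1 \<cdot>\<^bsub>D\<^esub> amap F a = amap F p\<^sub>1 \<cdot>\<^bsub>D\<^esub> amap F i\<^sub>1"
    using F.amap_Comp[OF a p1] F.amap_Comp[OF i1 p1] by simp
  then have Fa: "amap F a = amap F i\<^sub>1"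
    using F.cod.iso_left_cancel[OF iso] F.amap_in_Hom p1 a i1 by blast
  have ci1: "c \<cdot> i\<^sub>1 = g"
    unfolding c_def using Add_Comp[OF i1 gp1 hp2] Comp_assoc[OF i1 p1 g] Comp_assoc[OF i1 p2 h]
      p1i1 p2i1 Comp_Ident[OF g] Comp_Zero[OF h X] Add_Zero[OF X Y g] by simp
  have ci2: "c \<cdot> i\<^sub>2 = h"
    unfolding c_def using Add_Comp[OF i2 gp1 hp2] Comp_assoc[OF i2 p1 g] Comp_assoc[OF i2 p2 h]
      p1i2 p2i2 Comp_Ident[OF h] Comp_Zero[OF g K'] Zero_Add[OF K' Y h] by simp
  have "c \<cdot> a = g \<boxplus> (h \<cdot> k)"
    unfolding a_def using Comp_Add[OF i1 i2k c] ci1 ci2 Comp_assoc[OF k i2 c] by simp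
  also have "\<dots> = f"
    using diff_Add_cancel[OF f g] hk Add_commute[OF X Y g] Comp_in_Hom[OF k h] by simp
  finally show ?thesis
    using F.amap_Comp[OF a c] F.amap_Comp[OF i1 c] ci1 Fa by simp
qed


section \<open>Objects of \<open>T * \<Sigma>T\<close> resolve all objects\<close>

lemma star_triangle:
  assumes "A \<in> \<S>"
  obtains T\<^sub>1 T\<^sub>0 f g h where "T\<^sub>1 \<in> T" "T\<^sub>0 \<in> T" "f \<in> Hom C T\<^sub>1 T\<^sub>0" "g \<in> Hom C T\<^sub>0 A"
    "h \<in> Hom C A (omap (Susp C) T\<^sub>1)" "(f, g, h) \<in> Triangles C"
  using assms unfolding T_star_Susp_T_def by blast

lemma star_objs: "A \<in> \<S> \<Longrightarrow> A \<in> Obj C"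
  unfolding T_star_Susp_T_def by blast

text \<open>A zero object is a summand of every object, and \<open>T\<close> is nonempty because approximations exist.\<close>

lemma zero_object_in_T:
  obtains O' where "zero_object C O'" "O' \<in> T"
proof -
  obtain O' where O': "zero_object C O'" "O' \<in> Obj C"
    using ex_zero_object unfolding zero_object_def by blast
  obtain D where D: "D \<in> T"
    using T_approximations O'(2) unfolding contravariantly_finite_def right_approximation_def by blast
  note D' = T_objs[OF D]
  have "Ident C O' = Zero C O' O'"
    using zero_object_Hom(1)[OF O'(1) Ident_in_Hom[OF O'(2)]] .
  moreover have "Zero C O' D \<cdot> Zero C D O' = Zero C D D" "Zero C D O' \<cdot> Zero C O' D = Zero C O' O'"
    "Ident C D \<cdot> Zero C O' D = Zero C O' D" "Zero C D O' \<cdot> Ident C D = Zero C D O'"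
    using Comp_Zero Zero_in_Hom Ident_Comp Comp_Ident D' O'(2) by blast+
  ultimately have "biproduct C O' D D (Zero C O' D) (Ident C D) (Zero C D O') (Ident C D)"
    unfolding biproduct_def
    using D' O'(2) Zero_in_Hom Ident_in_Hom[OF D'] Ident_Comp[OF Ident_in_Hom[OF D']]
      Zero_Add[OF D' D' Ident_in_Hom[OF D']] by simp
  then have "O' \<in> T"
    using T_summands D D' O'(2) unfolding closed_under_summands_def by blast
  with that O'(1) show thesis by blast
qed

lemma Susp_T_star:
  assumes "D \<in> T"
  shows "omap (Susp C) D \<in> \<S>"
proof -
  obtain O' where O': "zero_object C O'" "O' \<in> T"
    using zero_object_in_T .
  have D: "D \<in> Obj C" "O' \<in> Obj C" "omap (Susp C) D \<in> Obj C"
    using assms T_objs O' Susp.omap_in_Obj by auto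
  have "(Zero C D O', Zero C O' (omap (Susp C) D), Neg C (amap (Susp C) (Ident C D))) \<in> Triangles C"
    by (rule rotate[OF TR1_Ident[OF D(1) O'(1)]])
  moreover have "Neg C (amap (Susp C) (Ident C D)) \<in> Hom C (omap (Susp C) D) (omap (Susp C) D)"
    using Neg_in_Hom[OF D(3,3)] Susp.amap_in_Hom[OF Ident_in_Hom[OF D(1)]] by blast
  ultimately show ?thesis
    unfolding T_star_Susp_T_def using assms O'(2) D Zero_in_Hom by blast
qed

text \<open>For \<open>A\<close> in \<open>T * \<Sigma>T\<close> the map \<open>g : T\<^sub>0 \<rightarrow> A\<close> is a right approximation, so a morphism out of \<open>A\<close> is
  determined up to \<open>\<approx>\<close> by its composite with \<open>g\<close>. That composite lifts along \<open>w\<close>, and the lift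
  descends to \<open>A\<close> because its composite with \<open>T\<^sub>1 \<rightarrow> T\<^sub>0\<close> vanishes.\<close>

lemma lift_along_W:
  assumes A: "A \<in> \<S>" and w: "w \<in> \<W>" "w \<in> Hom C X Y" and h: "h \<in> Hom C A Y"
  obtains k where "k \<in> Hom C A X" "w \<cdot> k \<approx> h"
proof -
  obtain T\<^sub>1 T\<^sub>0 f g e where T: "T\<^sub>1 \<in> T" "T\<^sub>0 \<in> T" and f: "f \<in> Hom C T\<^sub>1 T\<^sub>0" and g: "g \<in> Hom C T\<^sub>0 A"
    and e: "e \<in> Hom C A (omap (Susp C) T\<^sub>1)" and tri: "(f, g, e) \<in> Triangles C"
    using star_triangle[OF A] .
  have X: "X \<in> Obj C" and Y: "Y \<in> Obj C"
    using Hom_objs w(2) by blast+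
  obtain m where m: "m \<in> Hom C T\<^sub>0 X" "h \<cdot> g = w \<cdot> m"
    using W_surjective[OF w T(2) Comp_in_Hom[OF g h]] .
  have "m \<cdot> f = Zero C T\<^sub>1 X"
  proof (rule W_injective[OF w T(1) Comp_in_Hom[OF f m(1)] Zero_in_Hom[OF T_objs[OF T(1)] X]])
    show "w \<cdot> (m \<cdot> f) = w \<cdot> Zero C T\<^sub>1 X"
      using Comp_assoc[OF f m(1) w(2)] m(2) Comp_assoc[OF f g h] triangle_Comp_Zero[OF tri f g]
        Comp_Zero[OF h T_objs[OF T(1)]] Comp_Zero[OF w(2) T_objs[OF T(1)]] by simp
  qed
  then obtain k where k: "k \<in> Hom C A X" "m = k \<cdot> g"
    using triangle_factor_left[OF tri f g m(1)] by blast
  have "(w \<cdot> k) \<cdot> t = h \<cdot> t" if t: "D \<in> T" "t \<in> Hom C D A" for D t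
  proof -
    have "e \<cdot> t = Zero C D (omap (Susp C) T\<^sub>1)"
      using Hom_T_perp[OF t(1) Susp_T_perp[OF T(1)] Comp_in_Hom[OF t(2) e]] .
    then obtain s where s: "s \<in> Hom C D T\<^sub>0" "t = g \<cdot> s"
      using triangle_factor_right[OF rotate[OF tri] g e t(2)] by blast
    have "(w \<cdot> k) \<cdot> t = ((w \<cdot> k) \<cdot> g) \<cdot> s"
      using Comp_assoc[OF s(1) g Comp_in_Hom[OF k(1) w(2)]] s(2) by simp
    also have "(w \<cdot> k) \<cdot> g = h \<cdot> g"
      using Comp_assoc[OF g k(1) w(2)] k(2) m(2) by simp
    finally show ?thesis
      using Comp_assoc[OF s(1) g h] s(2) by simp
  qed
  then show thesis
    using that k(1) T_equal_iff[OF Comp_in_Hom[OF k(1) w(2)] h] by blast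
qed

text \<open>The presentation of the functor \<open>C(-, X)\<close> on \<open>T\<close> by two approximations \<open>p : T\<^sub>0 \<rightarrow> X\<close> and
  \<open>r : T\<^sub>1 \<rightarrow> Y\<close>, where \<open>Y\<close> is the fibre of \<open>p\<close>, is realised by the cone of \<open>T\<^sub>1 \<rightarrow> T\<^sub>0\<close>.
  Since the composite \<open>T\<^sub>1 \<rightarrow> T\<^sub>0 \<rightarrow> X\<close> vanishes, \<open>p\<close> extends to this cone.\<close>

lemma resolution:
  assumes X: "X \<in> Obj C"
  obtains A q where "A \<in> \<S>" "q \<in> Hom C A X" "q \<in> \<W>"
proof -
  obtain T\<^sub>0 p where T0: "T\<^sub>0 \<in> T" and p: "p \<in> Hom C T\<^sub>0 X"
    and app_p: "\<And>D g. \<lbrakk>D \<in> T; g \<in> Hom C D X\<rbrakk> \<Longrightarrow> \<exists>h \<in> Hom C D T\<^sub>0. g = p \<cdot> h"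
    using T_approximations X unfolding contravariantly_finite_def right_approximation_def by metis
  obtain Y y v where y: "y \<in> Hom C Y T\<^sub>0" and tri: "(y, p, v) \<in> Triangles C"
    using complete_triangle_left[OF p] by metis
  have Y: "Y \<in> Obj C"
    using Hom_objs y by blast
  obtain T\<^sub>1 r where T1: "T\<^sub>1 \<in> T" and r: "r \<in> Hom C T\<^sub>1 Y"
    and app_r: "\<And>D g. \<lbrakk>D \<in> T; g \<in> Hom C D Y\<rbrakk> \<Longrightarrow> \<exists>h \<in> Hom C D T\<^sub>1. g = r \<cdot> h"
    using T_approximations Y unfolding contravariantly_finite_def right_approximation_def by metis
  note yr = Comp_in_Hom[OF r y]
  obtain g h where tri': "(y \<cdot> r, g, h) \<in> Triangles C"
    using TR1_complete Hom_eqs[OF yr] by blast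
  obtain A where g: "g \<in> Hom C T\<^sub>0 A" and h: "h \<in> Hom C A (omap (Susp C) T\<^sub>1)"
    using triangle_Homs[OF tri'] Hom_eqs[OF yr] by (metis Hom_eqs)
  have A': "A \<in> Obj C"
    using Hom_objs g by blast
  have A: "A \<in> \<S>"
    unfolding T_star_Susp_T_def using A' T0 T1 yr g h tri' by blast
  have "p \<cdot> (y \<cdot> r) = Zero C T\<^sub>1 X"
    using Comp_assoc[OF r y p] triangle_Comp_Zero[OF tri y p] Zero_Comp[OF r X] by simp
  then obtain q where q: "q \<in> Hom C A X" "p = q \<cdot> g"
    using triangle_factor_left[OF tri' yr g p] by blast
  have "T_bijective q"
    unfolding T_bijective_iff[OF q(1)]
  proof (intro conjI ballI impI)
    fix D t assume D: "D \<in> T" and t: "t \<in> Hom C D A" "q \<cdot> t = Zero C D X"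
    have "h \<cdot> t = Zero C D (omap (Susp C) T\<^sub>1)"
      using Hom_T_perp[OF D Susp_T_perp[OF T1] Comp_in_Hom[OF t(1) h]] .
    then obtain s where s: "s \<in> Hom C D T\<^sub>0" "t = g \<cdot> s"
      using triangle_factor_right[OF rotate[OF tri'] g h t(1)] by blast
    have "p \<cdot> s = Zero C D X"
      using t(2) s(2) q(2) Comp_assoc[OF s(1) g q(1)] by simp
    then obtain m where m: "m \<in> Hom C D Y" "s = y \<cdot> m"
      using triangle_factor_right[OF tri y p s(1)] by blast
    obtain n where n: "n \<in> Hom C D T\<^sub>1" "m = r \<cdot> n"
      using app_r[OF D m(1)] by blast
    have "t = (g \<cdot> (y \<cdot> r)) \<cdot> n"
      using s(2) m(2) n(2) Comp_assoc[OF n(1) yr g] Comp_assoc[OF n(1) r y] by simp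
    then show "t = Zero C D A"
      using triangle_Comp_Zero[OF tri' yr g] Zero_Comp[OF n(1) A'] by simp
  next
    fix D x assume D: "D \<in> T" and x: "x \<in> Hom C D X"
    obtain d where d: "d \<in> Hom C D T\<^sub>0" "x = p \<cdot> d"
      using app_p[OF D x] by blast
    then have "x = q \<cdot> (g \<cdot> d)"
      using q(2) Comp_assoc[OF d(1) g q(1)] by simp
    then show "\<exists>t \<in> Hom C D A. x = q \<cdot> t"
      using Comp_in_Hom[OF d(1) g] by blast
  qed
  then show thesis
    using that A q(1) W_iff_T_bijective by blast
qed

end

section \<open>The quotient of \<open>T * \<Sigma>T\<close> by \<open>(\<Sigma>T)\<close>\<close>

context rigid_contravariantly_finite
begin

abbreviation "\<Q> \<equiv> star_quotient C T"
abbreviation "cls \<equiv> ideal_class (star_subcat C T) (Susp_ideal C T)"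

lemma Hom_star: "Hom (star_subcat C T) A B = (if A \<in> \<S> \<and> B \<in> \<S> then Hom C A B else {})"
  by (auto simp: star_subcat_def full_subcat_def Hom_def)

lemma star_simps:
  "Obj (star_subcat C T) = \<S>" "Dom (star_subcat C T) = Dom C" "Cod (star_subcat C T) = Cod C"
  "Ident (star_subcat C T) = Ident C" "Comp (star_subcat C T) = Comp C"
  "Add (star_subcat C T) = Add C"
  by (simp_all add: star_subcat_def full_subcat_def)

lemma Arr_star: "f \<in> Arr (star_subcat C T) \<longleftrightarrow> (\<exists>A \<in> \<S>. \<exists>B \<in> \<S>. f \<in> Hom C A B)"
  by (auto simp: star_subcat_def full_subcat_def Hom_def)

lemma Neg_star:
  assumes "A \<in> \<S>" "B \<in> \<S>" "f \<in> Hom C A B"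
  shows "Neg (star_subcat C T) f = Neg C f"
proof -
  have "hom_group (star_subcat C T) A B = hom_group C A B"
    using assms by (simp add: hom_group_def Hom_star star_simps)
      (simp add: star_subcat_def full_subcat_def)
  then show ?thesis
    using Hom_eqs[OF assms(3)] by (simp add: Neg_def star_simps)
qed

text \<open>A morphism out of an object of \<open>T * \<Sigma>T\<close> that is killed by \<open>T\<close> vanishes on \<open>T\<^sub>0\<close>, so it factors
  through \<open>A \<rightarrow> \<Sigma>T\<^sub>1\<close>. Thus \<open>(\<Sigma>T)\<close> and \<open>(T\<^sup>\<bottom>)\<close> cut out the same ideal of \<open>T * \<Sigma>T\<close>.\<close>

lemma Susp_ideal_iff:
  assumes A: "A \<in> \<S>" and B: "B \<in> \<S>" and f: "f \<in> Hom C A B"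
  shows "f \<in> Susp_ideal C T \<longleftrightarrow> f \<approx> Zero C A B"
proof
  assume "f \<in> Susp_ideal C T"
  then obtain K g h where K: "K \<in> suspension C T" and "g \<in> Hom C A K" "h \<in> Hom C K B" "f = h \<cdot> g"
    unfolding Susp_ideal_def factor_ideal_def using Hom_eqs[OF f]
    by (auto simp: star_simps Hom_star split: if_splits)
  then have "f \<in> factor_ideal C (right_perp C T)"
    using T_rigid Hom_eqs[OF f] unfolding factor_ideal_def rigid_def by blast
  then show "f \<approx> Zero C A B"
    using factor_perp_iff[OF f] by blast
next
  assume f0: "f \<approx> Zero C A B"
  obtain T\<^sub>1 T\<^sub>0 e g h where T: "T\<^sub>1 \<in> T" "T\<^sub>0 \<in> T" and g: "g \<in> Hom C T\<^sub>0 A"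
    and h: "h \<in> Hom C A (omap (Susp C) T\<^sub>1)" and tri: "(e, g, h) \<in> Triangles C"
    using star_triangle[OF A] by metis
  have "f \<cdot> g = Zero C T\<^sub>0 B"
    using f0 T_equal_Zero_iff[OF f] T(2) g by blast
  then obtain k where "k \<in> Hom C (omap (Susp C) T\<^sub>1) B" "f = k \<cdot> h"
    using triangle_factor_left[OF rotate[OF tri] g h f] by blast
  moreover have "omap (Susp C) T\<^sub>1 \<in> suspension C T" "f \<in> Arr (star_subcat C T)"
    using T(1) A B f unfolding suspension_def Arr_star by blast+
  ultimately show "f \<in> Susp_ideal C T"
    unfolding Susp_ideal_def factor_ideal_def using h Hom_eqs[OF f] A B Susp_T_star[OF T(1)]
    by (auto simp: star_simps Hom_star)
qed

lemma cls_eq: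
  assumes "A \<in> \<S>" "B \<in> \<S>" "f \<in> Hom C A B"
  shows "cls f = {g \<in> Hom C A B. g \<approx> f}"
proof -
  have "g \<boxplus> Neg C f \<in> Susp_ideal C T \<longleftrightarrow> g \<approx> f" if "g \<in> Hom C A B" for g
    using Susp_ideal_iff[OF assms(1,2) diff_in_Hom[OF that assms(3)]] T_equal_iff_diff[OF that assms(3)]
    by blast
  then show ?thesis
    unfolding ideal_class_def using Hom_eqs[OF assms(3)] Neg_star[OF assms] assms(1,2)
    by (auto simp: star_simps Hom_star)
qed

lemma cls_eq_iff:
  assumes "A \<in> \<S>" "B \<in> \<S>" "f \<in> Hom C A B" "g \<in> Hom C A B"
  shows "cls f = cls g \<longleftrightarrow> f \<approx> g"
  using cls_eq[OF assms(1-3)] cls_eq[OF assms(1,2,4)] assms T_equal_refl T_equal_sym T_equal_trans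
  by blast

lemma cls_representative:
  assumes "A \<in> \<S>" "B \<in> \<S>" "f \<in> Hom C A B"
  shows "(SOME g. g \<in> cls f) \<in> Hom C A B" "(SOME g. g \<in> cls f) \<approx> f"
proof -
  have "f \<in> cls f"
    using cls_eq[OF assms] assms(3) T_equal_refl by blast
  then have "(SOME g. g \<in> cls f) \<in> cls f"
    by (rule someI)
  then show "(SOME g. g \<in> cls f) \<in> Hom C A B" "(SOME g. g \<in> cls f) \<approx> f"
    using cls_eq[OF assms] by auto
qed

lemma quotient_simps:
  "Obj \<Q> = \<S>" "Arr \<Q> = cls ` Arr (star_subcat C T)" "Ident \<Q> X = cls (Ident C X)"
  by (simp_all add: star_quotient_def quotient_cat_def star_simps)

lemma Arr_quotientE:
  assumes "\<phi> \<in> Arr \<Q>"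
  obtains A B f where "A \<in> \<S>" "B \<in> \<S>" "f \<in> Hom C A B" "\<phi> = cls f"
  using assms Arr_star unfolding quotient_simps by blast

lemma Hom_quotient: "Hom \<Q> A B = (if A \<in> \<S> \<and> B \<in> \<S> then cls ` Hom C A B else {})"
proof -
  have ends: "Dom \<Q> (cls f) = A' \<and> Cod \<Q> (cls f) = B'"
    if "A' \<in> \<S>" "B' \<in> \<S>" "f \<in> Hom C A' B'" for A' B' f
    using Hom_eqs[OF cls_representative(1)[OF that]]
    by (simp add: star_quotient_def quotient_cat_def star_simps)
  have "\<phi> \<in> Hom \<Q> A B \<longleftrightarrow> A \<in> \<S> \<and> B \<in> \<S> \<and> \<phi> \<in> cls ` Hom C A B" for \<phi>
  proof
    assume "\<phi> \<in> Hom \<Q> A B"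
    then have \<phi>: "\<phi> \<in> Arr \<Q>" "Dom \<Q> \<phi> = A" "Cod \<Q> \<phi> = B"
      by (simp_all add: Hom_def)
    obtain A' B' f where f: "A' \<in> \<S>" "B' \<in> \<S>" "f \<in> Hom C A' B'" "\<phi> = cls f"
      using Arr_quotientE[OF \<phi>(1)] .
    then have "A' = A" "B' = B"
      using ends[OF f(1-3)] \<phi>(2,3) by auto
    then show "A \<in> \<S> \<and> B \<in> \<S> \<and> \<phi> \<in> cls ` Hom C A B"
      using f by blast
  next
    assume "A \<in> \<S> \<and> B \<in> \<S> \<and> \<phi> \<in> cls ` Hom C A B"
    then obtain f where f: "A \<in> \<S>" "B \<in> \<S>" "f \<in> Hom C A B" "\<phi> = cls f"
      by blast
    then have "\<phi> \<in> Arr \<Q>"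
      unfolding quotient_simps using Arr_star by blast
    then show "\<phi> \<in> Hom \<Q> A B"
      using ends[OF f(1-3)] f(4) by (simp add: Hom_def)
  qed
  then show ?thesis
    by auto
qed

lemma Hom_quotientE:
  assumes "\<phi> \<in> Hom \<Q> A B"
  obtains f where "A \<in> \<S>" "B \<in> \<S>" "f \<in> Hom C A B" "\<phi> = cls f"
  using assms unfolding Hom_quotient by (auto split: if_splits)

lemma cls_in_Hom: "\<lbrakk>A \<in> \<S>; B \<in> \<S>; f \<in> Hom C A B\<rbrakk> \<Longrightarrow> cls f \<in> Hom \<Q> A B"
  using Hom_quotient by simp

lemma Comp_cls:
  assumes "A \<in> \<S>" "B \<in> \<S>" "B' \<in> \<S>" "f \<in> Hom C A B" "g \<in> Hom C B B'"
  shows "cls g \<cdot>\<^bsub>\<Q>\<^esub> cls f = cls (g \<cdot> f)"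
proof -
  note f' = cls_representative[OF assms(1,2,4)] and g' = cls_representative[OF assms(2,3,5)]
  have "(SOME g'. g' \<in> cls g) \<cdot> (SOME f'. f' \<in> cls f) \<approx> g \<cdot> f"
    using T_equal_trans[OF T_equal_Comp_left[OF f'(2,1) g'(1)] T_equal_Comp_right[OF g'(2,1) assms(4)]] .
  then show ?thesis
    using cls_eq_iff[OF assms(1,3) Comp_in_Hom[OF f'(1) g'(1)] Comp_in_Hom[OF assms(4,5)]]
    by (simp add: star_quotient_def quotient_cat_def star_simps)
qed

lemma category_quotient: "category \<Q>"
proof
  have "Dom \<Q> \<phi> \<in> Obj \<Q> \<and> Cod \<Q> \<phi> \<in> Obj \<Q>" if \<phi>: "\<phi> \<in> Arr \<Q>" for \<phi>
  proof -
    obtain A B f where f: "A \<in> \<S>" "B \<in> \<S>" "f \<in> Hom C A B" "\<phi> = cls f"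
      using Arr_quotientE[OF \<phi>] .
    then show ?thesis
      using cls_in_Hom[OF f(1-3)] by (simp add: Hom_def quotient_simps(1))
  qed
  then show "Dom \<Q> \<phi> \<in> Obj \<Q>" "Cod \<Q> \<phi> \<in> Obj \<Q>" if "\<phi> \<in> Arr \<Q>" for \<phi>
    using that by auto
  show "Ident \<Q> X \<in> Hom \<Q> X X" if "X \<in> Obj \<Q>" for X
    using that cls_in_Hom Ident_in_Hom star_objs by (simp add: quotient_simps)
next
  fix \<phi> X Y assume "\<phi> \<in> Hom \<Q> X Y"
  then obtain f where f: "X \<in> \<S>" "Y \<in> \<S>" "f \<in> Hom C X Y" "\<phi> = cls f"
    by (rule Hom_quotientE)
  show "\<phi> \<cdot>\<^bsub>\<Q>\<^esub> Ident \<Q> X = \<phi>"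
    using Comp_cls[OF f(1,1,2) Ident_in_Hom[OF star_objs[OF f(1)]] f(3)] Comp_Ident[OF f(3)] f(4)
    by (simp add: quotient_simps)
  show "Ident \<Q> Y \<cdot>\<^bsub>\<Q>\<^esub> \<phi> = \<phi>"
    using Comp_cls[OF f(1,2,2,3) Ident_in_Hom[OF star_objs[OF f(2)]]] Ident_Comp[OF f(3)] f(4)
    by (simp add: quotient_simps)
  fix \<psi> Z assume "\<psi> \<in> Hom \<Q> Y Z"
  then obtain g where g: "Z \<in> \<S>" "g \<in> Hom C Y Z" "\<psi> = cls g"
    by (rule Hom_quotientE)
  have gf: "\<psi> \<cdot>\<^bsub>\<Q>\<^esub> \<phi> = cls (g \<cdot> f)"
    using Comp_cls[OF f(1,2) g(1) f(3) g(2)] f(4) g(3) by simp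
  then show "\<psi> \<cdot>\<^bsub>\<Q>\<^esub> \<phi> \<in> Hom \<Q> X Z"
    using cls_in_Hom[OF f(1) g(1) Comp_in_Hom[OF f(3) g(2)]] by simp
  fix \<chi> V assume "\<chi> \<in> Hom \<Q> Z V"
  then obtain h where h: "V \<in> \<S>" "h \<in> Hom C Z V" "\<chi> = cls h"
    by (rule Hom_quotientE)
  show "(\<chi> \<cdot>\<^bsub>\<Q>\<^esub> \<psi>) \<cdot>\<^bsub>\<Q>\<^esub> \<phi> = \<chi> \<cdot>\<^bsub>\<Q>\<^esub> (\<psi> \<cdot>\<^bsub>\<Q>\<^esub> \<phi>)"
    using gf f(4) g(3) h(3) Comp_cls[OF f(2) g(1) h(1) g(2) h(2)]
      Comp_cls[OF f(1,2) h(1) f(3) Comp_in_Hom[OF g(2) h(2)]]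
      Comp_cls[OF f(1) g(1) h(1) Comp_in_Hom[OF f(3) g(2)] h(2)] Comp_assoc[OF f(3) g(2) h(2)]
    by simp
qed

sublocale Q: category \<Q>
  by (rule category_quotient)

text \<open>The inverse of the class of \<open>w\<close> is obtained by lifting the identity along \<open>w\<close>.\<close>

lemma W_invertible_in_quotient:
  assumes w: "w \<in> \<W>" "w \<in> Hom C A B" and A: "A \<in> \<S>" and B: "B \<in> \<S>"
  shows "is_iso \<Q> (cls w)"
proof -
  note idA = Ident_in_Hom[OF star_objs[OF A]] and idB = Ident_in_Hom[OF star_objs[OF B]]
  obtain k where k: "k \<in> Hom C B A" "w \<cdot> k \<approx> Ident C B"
    using lift_along_W[OF B w idB] .
  note wk = Comp_in_Hom[OF k(1) w(2)] and kw = Comp_in_Hom[OF w(2) k(1)]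
  have "w \<cdot> (k \<cdot> w) \<approx> w \<cdot> Ident C A"
    using T_equal_Comp_right[OF k(2) wk w(2)] Comp_assoc[OF w(2) k(1) w(2)] Ident_Comp[OF w(2)]
      Comp_Ident[OF w(2)] by simp
  then have "k \<cdot> w \<approx> Ident C A"
    using W_left_cancel[OF w kw idA] by blast
  then show ?thesis
    using Q.is_isoI[OF cls_in_Hom[OF A B w(2)] cls_in_Hom[OF B A k(1)]]
      Comp_cls[OF A B A w(2) k(1)] Comp_cls[OF B A B k(1) w(2)] cls_eq_iff[OF A A kw idA]
      cls_eq_iff[OF B B wk idB] k(2) by (simp add: quotient_simps)
qed

text \<open>A choice of resolutions \<open>q : QX \<rightarrow> X\<close> becomes functorial in the quotient, because morphisms lift
  along \<open>q\<close> uniquely up to \<open>\<approx>\<close>. The functor is a strict retraction onto the quotient when the objects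
  of \<open>T * \<Sigma>T\<close> are resolved by themselves.\<close>

lemma resolution_functor:
  obtains F q where
    "\<And>X. X \<in> Obj C \<Longrightarrow> omap F X \<in> \<S> \<and> q X \<in> Hom C (omap F X) X \<and> q X \<in> \<W>"
    "\<And>A. A \<in> \<S> \<Longrightarrow> omap F A = A"
    "\<And>A B f. \<lbrakk>A \<in> \<S>; B \<in> \<S>; f \<in> Hom C A B\<rbrakk> \<Longrightarrow> amap F f = cls f"
    "\<And>f X Y. f \<in> Hom C X Y \<Longrightarrow>
      \<exists>h \<in> Hom C (omap F X) (omap F Y). amap F f = cls h \<and> q Y \<cdot> h \<approx> f \<cdot> q X"
    "cat_functor C \<Q> F" "inverts \<W> \<Q> F"
proof -
  have "\<forall>X \<in> Obj C. \<exists>A q. A \<in> \<S> \<and> q \<in> Hom C A X \<and> q \<in> \<W> \<and> (X \<in> \<S> \<longrightarrow> A = X \<and> q = Ident C X)"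
  proof
    fix X assume X: "X \<in> Obj C"
    show "\<exists>A q. A \<in> \<S> \<and> q \<in> Hom C A X \<and> q \<in> \<W> \<and> (X \<in> \<S> \<longrightarrow> A = X \<and> q = Ident C X)"
    proof (cases "X \<in> \<S>")
      case True
      then show ?thesis
        using Ident_in_Hom[OF X] Ident_in_W[OF X] by blast
    next
      case False
      then show ?thesis
        using resolution[OF X] by metis
    qed
  qed
  then obtain r q where rq: "\<And>X. X \<in> Obj C \<Longrightarrow> r X \<in> \<S>" "\<And>X. X \<in> Obj C \<Longrightarrow> q X \<in> Hom C (r X) X"
      "\<And>X. X \<in> Obj C \<Longrightarrow> q X \<in> \<W>" "\<And>X. X \<in> \<S> \<Longrightarrow> r X = X \<and> q X = Ident C X"
    using star_objs by metis
  let ?lift = "\<lambda>f h. h \<in> Hom C (r (Dom C f)) (r (Cod C f)) \<and> q (Cod C f) \<cdot> h \<approx> f \<cdot> q (Dom C f)"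
  define F where "F = \<lparr>omap = r, amap = \<lambda>f. cls (SOME h. ?lift f h)\<rparr>"
  have F_eqI: "amap F f = cls h"
    if f: "f \<in> Hom C X Y" and h: "h \<in> Hom C (r X) (r Y)" "q Y \<cdot> h \<approx> f \<cdot> q X" for f h X Y
  proof -
    have X: "X \<in> Obj C" and Y: "Y \<in> Obj C"
      using Hom_objs f by blast+
    have "?lift f h"
      using h Hom_eqs[OF f] by simp
    then have "?lift f (SOME h. ?lift f h)"
      by (rule someI)
    then have h': "(SOME h. ?lift f h) \<in> Hom C (r X) (r Y)" "q Y \<cdot> (SOME h. ?lift f h) \<approx> f \<cdot> q X"
      using Hom_eqs[OF f] by auto
    have "(SOME h. ?lift f h) \<approx> h"
      using W_left_cancel[OF rq(3,2)[OF Y] h'(1) h(1)] T_equal_trans[OF h'(2) T_equal_sym[OF h(2)]]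
      by blast
    then show ?thesis
      using cls_eq_iff[OF rq(1)[OF X] rq(1)[OF Y] h'(1) h(1)] by (simp add: F_def)
  qed
  have lift: "\<exists>h \<in> Hom C (r X) (r Y). amap F f = cls h \<and> q Y \<cdot> h \<approx> f \<cdot> q X"
    if f: "f \<in> Hom C X Y" for f X Y
  proof -
    have X: "X \<in> Obj C" and Y: "Y \<in> Obj C"
      using Hom_objs f by blast+
    obtain h where "h \<in> Hom C (r X) (r Y)" "q Y \<cdot> h \<approx> f \<cdot> q X"
      using lift_along_W[OF rq(1)[OF X] rq(3,2)[OF Y] Comp_in_Hom[OF rq(2)[OF X] f]] .
    then show ?thesis
      using F_eqI[OF f] by blast
  qed
  have F: "cat_functor C \<Q> F"
  proof
    show "omap F X \<in> Obj \<Q>" if "X \<in> Obj C" for X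
      using rq(1)[OF that] by (simp add: F_def quotient_simps)
    show "amap F f \<in> Hom \<Q> (omap F X) (omap F Y)" if "f \<in> Hom C X Y" for f X Y
      using lift[OF that] Hom_objs[OF that] rq(1) cls_in_Hom by (auto simp: F_def)
    show "amap F (Ident C X) = Ident \<Q> (omap F X)" if X: "X \<in> Obj C" for X
    proof -
      have "q X \<cdot> Ident C (r X) \<approx> Ident C X \<cdot> q X"
        using T_equal_refl Comp_Ident Ident_Comp rq(2)[OF X] by simp
      then show ?thesis
        using F_eqI[OF Ident_in_Hom[OF X] Ident_in_Hom[OF star_objs[OF rq(1)[OF X]]]]
        by (simp add: F_def quotient_simps)
    qed
    fix f g X Y Z assume f: "f \<in> Hom C X Y" and g: "g \<in> Hom C Y Z"
    have objs: "X \<in> Obj C" "Y \<in> Obj C" "Z \<in> Obj C"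
      using Hom_objs f g by blast+
    obtain h where h: "h \<in> Hom C (r X) (r Y)" "amap F f = cls h" "q Y \<cdot> h \<approx> f \<cdot> q X"
      using lift[OF f] by blast
    obtain k where k: "k \<in> Hom C (r Y) (r Z)" "amap F g = cls k" "q Z \<cdot> k \<approx> g \<cdot> q Y"
      using lift[OF g] by blast
    note qX = rq(2)[OF objs(1)] and qY = rq(2)[OF objs(2)] and qZ = rq(2)[OF objs(3)]
    have "q Z \<cdot> (k \<cdot> h) = (q Z \<cdot> k) \<cdot> h"
      using Comp_assoc[OF h(1) k(1) qZ] by simp
    also have "\<dots> \<approx> (g \<cdot> q Y) \<cdot> h"
      using T_equal_Comp_right[OF k(3) Comp_in_Hom[OF k(1) qZ] h(1)] .
    also have "\<dots> = g \<cdot> (q Y \<cdot> h)"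
      using Comp_assoc[OF h(1) qY g] .
    also have "\<dots> \<approx> g \<cdot> (f \<cdot> q X)"
      using T_equal_Comp_left[OF h(3) Comp_in_Hom[OF h(1) qY] g] .
    also have "\<dots> = (g \<cdot> f) \<cdot> q X"
      using Comp_assoc[OF qX f g] by simp
    finally have "amap F (g \<cdot> f) = cls (k \<cdot> h)"
      using F_eqI[OF Comp_in_Hom[OF f g] Comp_in_Hom[OF h(1) k(1)]] by blast
    then show "amap F (g \<cdot> f) = amap F g \<cdot>\<^bsub>\<Q>\<^esub> amap F f"
      using Comp_cls[OF rq(1)[OF objs(1)] rq(1)[OF objs(2)] rq(1)[OF objs(3)] h(1) k(1)] h(2) k(2)
      by simp
  qed
  have "inverts \<W> \<Q> F"
    unfolding inverts_def
  proof
    fix w assume w: "w \<in> \<W>"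
    then obtain X Y where w': "w \<in> Hom C X Y"
      using W_subset Hom_Dom_Cod by blast
    have X: "X \<in> Obj C" and Y: "Y \<in> Obj C"
      using Hom_objs w' by blast+
    obtain h where h: "h \<in> Hom C (r X) (r Y)" "amap F w = cls h" "q Y \<cdot> h \<approx> w \<cdot> q X"
      using lift[OF w'] by blast
    \<comment> \<open>Two out of three for bijectivity on \<open>C(D, -)\<close>.\<close>
    have eq: "q Y \<cdot> (h \<cdot> t) = w \<cdot> (q X \<cdot> t)" if "D \<in> T" "t \<in> Hom C D (r X)" for D t
      using h(3) that T_equal_iff[OF Comp_in_Hom[OF h(1) rq(2)[OF Y]] Comp_in_Hom[OF rq(2)[OF X] w']]
        Comp_assoc[OF that(2) h(1) rq(2)[OF Y]] Comp_assoc[OF that(2) rq(2)[OF X] w'] by simp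
    have "T_bijective h"
      unfolding T_bijective_iff[OF h(1)]
    proof (intro conjI ballI impI)
      fix D t assume D: "D \<in> T" and t: "t \<in> Hom C D (r X)" "h \<cdot> t = Zero C D (r Y)"
      note 0 = Zero_in_Hom[OF T_objs[OF D]]
      have "w \<cdot> (q X \<cdot> t) = w \<cdot> Zero C D X"
        using eq[OF D t(1)] t(2) Comp_Zero[OF rq(2)[OF Y] T_objs[OF D]] Comp_Zero[OF w' T_objs[OF D]]
        by simp
      then have "q X \<cdot> t = q X \<cdot> Zero C D (r X)"
        using W_injective[OF w w' D Comp_in_Hom[OF t(1) rq(2)[OF X]] 0[OF X]]
          Comp_Zero[OF rq(2)[OF X] T_objs[OF D]] by simp
      then show "t = Zero C D (r X)"
        using W_injective[OF rq(3,2)[OF X] D t(1) 0[OF star_objs[OF rq(1)[OF X]]]] by simp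
    next
      fix D y assume D: "D \<in> T" and y: "y \<in> Hom C D (r Y)"
      obtain x where x: "x \<in> Hom C D X" "q Y \<cdot> y = w \<cdot> x"
        using W_surjective[OF w w' D Comp_in_Hom[OF y rq(2)[OF Y]]] .
      obtain t where t: "t \<in> Hom C D (r X)" "x = q X \<cdot> t"
        using W_surjective[OF rq(3,2)[OF X] D x(1)] .
      have "y = h \<cdot> t"
        using W_injective[OF rq(3,2)[OF Y] D y Comp_in_Hom[OF t(1) h(1)]] x(2) t(2) eq[OF D t(1)]
        by simp
      then show "\<exists>t \<in> Hom C D (r X). y = h \<cdot> t"
        using t(1) by blast
    qed
    then show "is_iso \<Q> (amap F w)"
      using W_invertible_in_quotient[OF _ h(1) rq(1)[OF X] rq(1)[OF Y]] W_iff_T_bijective h(2) by simp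
  qed
  moreover have "amap F f = cls f" if AB: "A \<in> \<S>" "B \<in> \<S>" and f: "f \<in> Hom C A B" for A B f
  proof -
    have "f \<in> Hom C (r A) (r B)" "q B \<cdot> f \<approx> f \<cdot> q A"
      using rq(4)[OF AB(1)] rq(4)[OF AB(2)] f Ident_Comp Comp_Ident T_equal_refl by auto
    then show ?thesis
      using F_eqI[OF f] by blast
  qed
  moreover have "omap F X = r X" for X
    by (simp add: F_def)
  ultimately show thesis
    using that[of F q] rq lift F by simp
qed


section \<open>The induced functor\<close>

lemma induced_by_inclusion_iff:
  "induced_by_inclusion C T Loc L J \<longleftrightarrow> cat_functor \<Q> Loc J \<and>
    (\<forall>A \<in> \<S>. omap J A = omap L A) \<and>
    (\<forall>A \<in> \<S>. \<forall>B \<in> \<S>. \<forall>f \<in> Hom C A B. amap J (cls f) = amap L f)"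
  unfolding induced_by_inclusion_def functor_eq_def comp_functor_def quotient_functor_def
    id_functor_def by (auto simp: star_simps(1) Arr_star)

lemma ex_induced_functor:
  assumes L: "cat_functor C Loc L" "inverts \<W> Loc L"
  shows "\<exists>J. induced_by_inclusion C T Loc L J"
proof -
  interpret L: cat_functor C Loc L by fact
  define J where "J = \<lparr>omap = omap L, amap = \<lambda>\<phi>. amap L (SOME f. f \<in> \<phi>)\<rparr>"
  have J: "amap J (cls f) = amap L f" if "A \<in> \<S>" "B \<in> \<S>" "f \<in> Hom C A B" for A B f
    using inverting_W_identifies_T_equal[OF L cls_representative(2)[OF that]] by (simp add: J_def)
  have "cat_functor \<Q> Loc J"
  proof
    show "omap J X \<in> Obj Loc" if "X \<in> Obj \<Q>" for X
      using that star_objs L.omap_in_Obj by (simp add: J_def quotient_simps)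
    show "amap J \<phi> \<in> Hom Loc (omap J X) (omap J Y)" if \<phi>: "\<phi> \<in> Hom \<Q> X Y" for \<phi> X Y
    proof -
      obtain f where f: "X \<in> \<S>" "Y \<in> \<S>" "f \<in> Hom C X Y" "\<phi> = cls f"
        using Hom_quotientE[OF \<phi>] .
      then show ?thesis
        using J[OF f(1-3)] L.amap_in_Hom[OF f(3)] by (simp add: J_def)
    qed
    show "amap J (Ident \<Q> X) = Ident Loc (omap J X)" if "X \<in> Obj \<Q>" for X
      using that J[OF _ _ Ident_in_Hom] L.amap_Ident star_objs by (simp add: quotient_simps J_def)
    fix \<phi> \<psi> X Y Z assume \<phi>: "\<phi> \<in> Hom \<Q> X Y" and \<psi>: "\<psi> \<in> Hom \<Q> Y Z"
    obtain f where f: "X \<in> \<S>" "Y \<in> \<S>" "f \<in> Hom C X Y" "\<phi> = cls f"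
      using Hom_quotientE[OF \<phi>] .
    obtain g where g: "Z \<in> \<S>" "g \<in> Hom C Y Z" "\<psi> = cls g"
      using Hom_quotientE[OF \<psi>] .
    show "amap J (\<psi> \<cdot>\<^bsub>\<Q>\<^esub> \<phi>) = amap J \<psi> \<cdot>\<^bsub>Loc\<^esub> amap J \<phi>"
      using Comp_cls[OF f(1,2) g(1) f(3) g(2)] f(4) g(3) J[OF f(1-3)] J[OF f(2) g(1,2)]
        J[OF f(1) g(1) Comp_in_Hom[OF f(3) g(2)]] L.amap_Comp[OF f(3) g(2)] by simp
  qed
  then show ?thesis
    using J unfolding induced_by_inclusion_iff by (auto simp: J_def)
qed

text \<open>The resolution functor inverts \<open>\<W>\<close>, so it factors through the localisation by a functor \<open>G\<close>,
  which is a strict left inverse of \<open>J\<close>. The maps \<open>L (q X)\<close> are isomorphisms \<open>J (G (L X)) \<rightarrow> L X\<close>; they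
  are indexed by the objects of the localisation, as \<open>L\<close> is bijective on objects, and they are
  natural since they are natural on the image of \<open>L\<close>.\<close>

lemma induced_functor_is_equivalence:
  fixes Loc :: "('p, 'b) cat" and L :: "('o, 'a, 'p, 'b) funct"
  assumes loc: "is_localisation C \<W> Loc L" and J: "induced_by_inclusion C T Loc L J"
  shows "equivalence_functor \<Q> Loc J"
proof -
  have LF: "cat_functor C Loc L" and inv: "inverts \<W> Loc L"
    using loc unfolding is_localisation_def by blast+
  interpret L: cat_functor C Loc L by fact
  have JF: "cat_functor \<Q> Loc J" and J_omap: "\<And>A. A \<in> \<S> \<Longrightarrow> omap J A = omap L A"
    and J_cls: "\<And>A B f. \<lbrakk>A \<in> \<S>; B \<in> \<S>; f \<in> Hom C A B\<rbrakk> \<Longrightarrow> amap J (cls f) = amap L f"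
    using J unfolding induced_by_inclusion_iff by blast+
  obtain F q where
      F: "\<And>X. X \<in> Obj C \<Longrightarrow> omap F X \<in> \<S> \<and> q X \<in> Hom C (omap F X) X \<and> q X \<in> \<W>"
    and F_star: "\<And>A. A \<in> \<S> \<Longrightarrow> omap F A = A"
    and F_cls: "\<And>A B f. \<lbrakk>A \<in> \<S>; B \<in> \<S>; f \<in> Hom C A B\<rbrakk> \<Longrightarrow> amap F f = cls f"
    and F_lift: "\<And>f X Y. f \<in> Hom C X Y \<Longrightarrow>
      \<exists>h \<in> Hom C (omap F X) (omap F Y). amap F f = cls h \<and> q Y \<cdot> h \<approx> f \<cdot> q X"
    and F_functor: "cat_functor C \<Q> F" and inverts: "inverts \<W> \<Q> F"
    by (rule resolution_functor) (rule that)
  \<comment> \<open>A class is determined by any of its members, so choosing representatives is injective.\<close>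
  have "inj_on (\<lambda>\<phi>. SOME f. f \<in> \<phi>) (Arr \<Q>)"
  proof (rule inj_onI)
    fix \<phi> \<psi> assume "\<phi> \<in> Arr \<Q>" "\<psi> \<in> Arr \<Q>" and eq: "(SOME f. f \<in> \<phi>) = (SOME f. f \<in> \<psi>)"
    then obtain A B f A' B' g where f: "A \<in> \<S>" "B \<in> \<S>" "f \<in> Hom C A B" "\<phi> = cls f"
      and g: "A' \<in> \<S>" "B' \<in> \<S>" "g \<in> Hom C A' B'" "\<psi> = cls g"
      by (metis Arr_quotientE)
    note f' = cls_representative[OF f(1-3)] and g' = cls_representative[OF g(1-3)]
    have "A' = A" "B' = B"
      using Hom_eqs[OF f'(1)] Hom_eqs[OF g'(1)] eq f(4) g(4) by auto
    moreover have "f \<approx> g"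
      using T_equal_trans[OF T_equal_sym[OF f'(2)]] g'(2) eq f(4) g(4) by simp
    ultimately show "\<phi> = \<psi>"
      using cls_eq_iff[OF f(1-3)] f(4) g(3,4) by blast
  qed
  then obtain G where G: "cat_functor Loc \<Q> G" and FGL: "functor_eq C F (G \<circ>\<^sub>F L)"
    using universal_property_renaming_arrows[of C \<W> Loc L \<Q> F] loc W_subset F_functor inverts
    unfolding is_localisation_def by blast
  have GL: "\<And>X. X \<in> Obj C \<Longrightarrow> omap G (omap L X) = omap F X"
      "\<And>f X Y. f \<in> Hom C X Y \<Longrightarrow> amap G (amap L f) = amap F f"
    using FGL Hom_eqs unfolding functor_eq_def comp_functor_def by auto
  note GJ = cat_functor_comp[OF JF G] and JG = cat_functor_comp[OF G JF]
  have "naturally_isomorphic \<Q> \<Q> id_functor (G \<circ>\<^sub>F J)"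
    unfolding naturally_isomorphic_def
  proof (intro conjI exI ballI)
    fix A assume "A \<in> Obj \<Q>"
    then have A: "A \<in> \<S>" "A \<in> Obj \<Q>"
      by (simp_all add: quotient_simps)
    show "is_iso \<Q> (Ident \<Q> A)"
      by (rule Q.is_iso_Ident[OF A(2)])
    have "omap (G \<circ>\<^sub>F J) A = A"
      using A(1) GL(1) J_omap F_star star_objs by (simp add: comp_functor_def)
    then show "Ident \<Q> A \<in> Hom \<Q> (omap id_functor A) (omap (G \<circ>\<^sub>F J) A)"
      using Q.Ident_in_Hom[OF A(2)] by (simp add: id_functor_def)
  next
    fix \<phi> assume \<phi>: "\<phi> \<in> Arr \<Q>"
    then obtain A B f where f: "A \<in> \<S>" "B \<in> \<S>" "f \<in> Hom C A B" "\<phi> = cls f"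
      by (rule Arr_quotientE)
    then have "amap (G \<circ>\<^sub>F J) \<phi> = \<phi>"
      using GL(2) J_cls F_cls by (simp add: comp_functor_def)
    then show "Ident \<Q> (Cod \<Q> \<phi>) \<cdot>\<^bsub>\<Q>\<^esub> amap id_functor \<phi> = amap (G \<circ>\<^sub>F J) \<phi> \<cdot>\<^bsub>\<Q>\<^esub> Ident \<Q> (Dom \<Q> \<phi>)"
      using Q.Ident_Comp[OF Q.Hom_Dom_Cod[OF \<phi>]] Q.Comp_Ident[OF Q.Hom_Dom_Cod[OF \<phi>]]
      by (simp add: id_functor_def)
  qed (use cat_functor_id category_quotient GJ in auto)
  moreover have "naturally_isomorphic Loc Loc id_functor (J \<circ>\<^sub>F G)"
  proof -
    let ?I = "id_functor :: ('p, 'b, 'p, 'b) funct"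
    have "\<exists>e. e \<in> Hom Loc (omap L X) (omap L (omap F X)) \<and> is_iso Loc e \<and>
        e \<cdot>\<^bsub>Loc\<^esub> amap L (q X) = Ident Loc (omap L (omap F X)) \<and>
        amap L (q X) \<cdot>\<^bsub>Loc\<^esub> e = Ident Loc (omap L X)" if "X \<in> Obj C" for X
    proof -
      have iso: "is_iso Loc (amap L (q X))"
        using inv F[OF that] unfolding inverts_def by blast
      have Lq: "amap L (q X) \<in> Hom Loc (omap L (omap F X)) (omap L X)"
        using L.amap_in_Hom F[OF that] by blast
      show ?thesis
        using L.cod.is_isoE[OF iso Lq] L.cod.is_isoI Lq by metis
    qed
    then obtain e where
        e: "\<And>X. X \<in> Obj C \<Longrightarrow> e X \<in> Hom Loc (omap L X) (omap L (omap F X)) \<and> is_iso Loc (e X)"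
      and eq: "\<And>X. X \<in> Obj C \<Longrightarrow> e X \<cdot>\<^bsub>Loc\<^esub> amap L (q X) = Ident Loc (omap L (omap F X))"
      and qe: "\<And>X. X \<in> Obj C \<Longrightarrow> amap L (q X) \<cdot>\<^bsub>Loc\<^esub> e X = Ident Loc (omap L X)"
      by metis
    define \<eta> where "\<eta> P = e (inv_into (Obj C) (omap L) P)" for P
    have \<eta>L: "\<eta> (omap L X) = e X" if "X \<in> Obj C" for X
      using localisation_injective_on_objects[OF preadditive_category_axioms loc W_subset] that
      by (simp add: \<eta>_def)
    have \<eta>: "\<eta> P \<in> Hom Loc (omap ?I P) (omap (J \<circ>\<^sub>F G) P) \<and> is_iso Loc (\<eta> P)"
      if P: "P \<in> Obj Loc" for P
    proof -
      obtain X where X: "X \<in> Obj C" "P = omap L X"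
        using P localisation_objects[OF loc W_subset] by blast
      then show ?thesis
        using e[OF X(1)] \<eta>L[OF X(1)] GL(1)[OF X(1)] J_omap F[OF X(1)]
        by (simp add: id_functor_def comp_functor_def)
    qed
    have nat: "\<eta> (omap L Y) \<cdot>\<^bsub>Loc\<^esub> amap ?I (amap L f) =
        amap (J \<circ>\<^sub>F G) (amap L f) \<cdot>\<^bsub>Loc\<^esub> \<eta> (omap L X)" if f: "f \<in> Hom C X Y" for f X Y
    proof -
      have X: "X \<in> Obj C" and Y: "Y \<in> Obj C"
        using Hom_objs f by blast+
      obtain h where h: "h \<in> Hom C (omap F X) (omap F Y)" "amap F f = cls h" "q Y \<cdot> h \<approx> f \<cdot> q X"
        using F_lift[OF f] by blast
      have JGf: "amap (J \<circ>\<^sub>F G) (amap L f) = amap L h"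
        using GL(2)[OF f] h(2) J_cls[OF _ _ h(1)] F[OF X] F[OF Y] by (simp add: comp_functor_def)
      have qX: "q X \<in> Hom C (omap F X) X" and qY: "q Y \<in> Hom C (omap F Y) Y"
        using F X Y by auto
      note Lf = L.amap_in_Hom[OF f] and Lh = L.amap_in_Hom[OF h(1)]
        and LqX = L.amap_in_Hom[OF qX] and LqY = L.amap_in_Hom[OF qY]
      have eX: "e X \<in> Hom Loc (omap L X) (omap L (omap F X))"
        and eY: "e Y \<in> Hom Loc (omap L Y) (omap L (omap F Y))"
        using e X Y by auto
      have square: "amap L (q Y) \<cdot>\<^bsub>Loc\<^esub> amap L h = amap L f \<cdot>\<^bsub>Loc\<^esub> amap L (q X)"
        using inverting_W_identifies_T_equal[OF LF inv h(3)] L.amap_Comp[OF h(1) qY]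
          L.amap_Comp[OF qX f] by simp
      have "e Y \<cdot>\<^bsub>Loc\<^esub> amap L f = e Y \<cdot>\<^bsub>Loc\<^esub> (amap L f \<cdot>\<^bsub>Loc\<^esub> (amap L (q X) \<cdot>\<^bsub>Loc\<^esub> e X))"
        using qe[OF X] L.cod.Comp_Ident[OF Lf] by simp
      also have "\<dots> = e Y \<cdot>\<^bsub>Loc\<^esub> ((amap L (q Y) \<cdot>\<^bsub>Loc\<^esub> amap L h) \<cdot>\<^bsub>Loc\<^esub> e X)"
        using L.cod.Comp_assoc[OF eX LqX Lf] square by simp
      also have "\<dots> = (e Y \<cdot>\<^bsub>Loc\<^esub> amap L (q Y)) \<cdot>\<^bsub>Loc\<^esub> (amap L h \<cdot>\<^bsub>Loc\<^esub> e X)"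
        using L.cod.Comp_assoc[OF eX Lh LqY] L.cod.Comp_assoc[OF L.cod.Comp_in_Hom[OF eX Lh] LqY eY]
        by simp
      also have "\<dots> = amap L h \<cdot>\<^bsub>Loc\<^esub> e X"
        using eq[OF Y] L.cod.Ident_Comp[OF L.cod.Comp_in_Hom[OF eX Lh]] by simp
      finally show ?thesis
        using JGf \<eta>L X Y by (simp add: id_functor_def)
    qed
    note idL = cat_functor_id[OF L.cod.category_axioms]
    have "\<eta> (Cod Loc k) \<cdot>\<^bsub>Loc\<^esub> amap ?I k = amap (J \<circ>\<^sub>F G) k \<cdot>\<^bsub>Loc\<^esub> \<eta> (Dom Loc k)"
      if "k \<in> Arr Loc" for k
    proof (rule natural_if_natural_on_image[where \<eta> = \<eta>, OF loc W_subset idL JG _ _ that])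
      show "\<eta> P \<in> Hom Loc (omap ?I P) (omap (J \<circ>\<^sub>F G) P)" if "P \<in> Obj Loc" for P
        using \<eta>[OF that] by (rule conjunct1)
    qed (rule nat)
    then show ?thesis
      unfolding naturally_isomorphic_def using idL JG \<eta> by blast
  qed
  ultimately show ?thesis
    unfolding equivalence_functor_def using JF G by blast
qed

end

theorem corollary2p3:
  fixes C :: "('o, 'a, 'z) tricat_scheme" and T :: "'o set"
    and Loc :: "('p, 'b) cat" and L :: "('o, 'a, 'p, 'b) funct"
  assumes "triangulated_category C"
    and "strictly_full C T" and "closed_under_summands C T"
    and "contravariantly_finite C T" and "rigid C T"
    and "is_localisation C (W_class C T) Loc L"
  shows "(\<exists>J. induced_by_inclusion C T Loc L J) \<and>
         (\<forall>J. induced_by_inclusion C T Loc L J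
            \<longrightarrow> equivalence_functor (star_quotient C T) Loc J)"
proof -
  interpret rigid_contravariantly_finite C T
    using assms by (simp add: rigid_contravariantly_finite_def rigid_contravariantly_finite_axioms_def)
  have "cat_functor C Loc L" "inverts (W_class C T) Loc L"
    using assms(6) unfolding is_localisation_def by blast+
  then show ?thesis
    using ex_induced_functor induced_functor_is_equivalence[OF assms(6)] by blast
qed

end
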